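(* Let $u_h^0\in V$. Define a sequence $(u_h^n)_{n\ge 0}$ in $V$ by $u_h^0$ and the following procedure: given $u_h^n\in V$, for each $j=1,\dots,N$ let $u_{h,j}^{n+1}\in V_j$ be the solution of $$a_{\Omega_j}(u_{h,j}^{n+1},v_{h,j})=F(\mathcal R_{h,j}^\top v_{h,j})+b_{h,j}(u_h^n,v_{h,j})\quad\text{for all }v_{h,j}\in V_j,$$ and set $u_h^{n+1}:=\sum_{\ell}\widetilde{\mathcal R}_{h,\ell}^\top u_{h,\ell}^{n+1}$. Define a second sequence in $V$, with the same starting guess $u_h^0$, by the ORAS-preconditioned Richardson iteration $$u_h^{n+1}=u_h^n+\mathcal B_h^{-1}(F_h-\mathcal A_hu_h^n),\qquad \mathcal B_h^{-1}:=\sum_j\widetilde{\mathcal R}_{h,j}^\top\mathcal A_{h,j}^{-1}\mathcal R_{h,j}.$$ Then the iterates of the two sequences coincide for every $n$.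
   Context: Setting. $\Omega\subset\mathbb R^d$ ($d=2,3$) is a bounded Lipschitz (polygonal/polyhedral) domain, $k>0$, $f\in L^2(\Omega)$, $g\in L^2(\partial\Omega)$. $V\subset H^1(\Omega)$ is the nodal finite element space of (complex-valued) continuous piecewise polynomials of total degree $\le p$ on a conforming simplicial mesh $T^h$ of $\Omega$; $V'$ is its dual. $\{\Omega_j\}_{j=1}^N$ is an overlapping cover of $\Omega$ by Lipschitz polygonal/polyhedral subdomains whose boundaries are resolved by $T^h$. $V_j:=\{v_h|_{\overline{\Omega_j}}:v_h\in V\}$. For a subdomain $D\subset\Omega$, $a_D(v,w):=\int_D(\nabla v\cdot\overline{\nabla w}-k^2v\overline w)-\mathrm{i}k\int_{\partial D}v\overline w$, and $a:=a_\Omega$. $F(v):=\int_\Omega f\overline v+\int_{\partial\Omega}g\overline v$. Operators: $\mathcal A_h:V\to V'$, $(\mathcal A_hu_h)(v_h)=a(u_h,v_h)$; $F_h\in V'$, $F_h(v_h)=F(v_h)$; $\mathcal A_{h,j}:V_j\to V_j'$, $(\mathcal A_{h,j}v)(w)=a_{\Omega_j}(v,w)$. $\mathcal R_{h,j}^\top:V_j\to V$ is the zero nodal extension: $\mathcal R_{h,j}^\top v_{h,j}$ equals $v_{h,j}$ at finite element nodes in $\overline{\Omega_j}$ and $0$ at all other nodes of $\overline\Omega$. $\mathcal R_{h,j}:V'\to V_j'$ is defined by $(\mathcal R_{h,j}G_h)(v_{h,j})=G_h(\mathcal R_{h,j}^\top v_{h,j})$. $\{\chi_j\}$ is a partition of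 unity: $\operatorname{supp}\chi_j\subset\overline{\Omega_j}$, $0\le\chi_j\le1$, $\sum_j\chi_j=1$ on $\overline\Omega$. $\widetilde{\mathcal R}_{h,j}^\top v_{h,j}:=\mathcal R_{h,j}^\top(\Pi_h(\chi_jv_{h,j}))$, with $\Pi_h$ nodal interpolation. For $w\in H^1(\Omega)$, $v_{h,j}\in V_j$: $b_{h,j}(w,v_{h,j}):=a_{\Omega_j}(w,v_{h,j})-a(w,\mathcal R_{h,j}^\top v_{h,j})$. Standing assumptions: the problem $a(u_h,v_h)=F(v_h)$ for all $v_h\in V$ has a unique solution $u_h\in V$, and each $\mathcal A_{h,j}:V_j\to V_j'$ is invertible. *)

theory Defs
  imports "HOL-Analysis.Analysis"
begin

subsection \<open>Lipschitz polyhedral domains and simplicial meshes\<close>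

text \<open>Near every boundary point the set is, in suitable orthonormal coordinates, the strict
  epigraph of a Lipschitz function of the coordinates orthogonal to \<open>e\<close>.\<close>

definition lipschitz_boundary :: "'a::euclidean_space set \<Rightarrow> bool" where
  "lipschitz_boundary D \<longleftrightarrow>
     (\<forall>x\<in>frontier D. \<exists>e r L. \<exists>\<gamma> :: 'a \<Rightarrow> real. norm e = 1 \<and> r > 0 \<and> L-lipschitz_on UNIV \<gamma> \<and>
        (\<forall>y\<in>ball x r. y \<in> D \<longleftrightarrow> y \<bullet> e > \<gamma> (y - (y \<bullet> e) *\<^sub>R e)))"

definition lipschitz_polyhedral :: "'a::euclidean_space set \<Rightarrow> bool" where
  "lipschitz_polyhedral D \<longleftrightarrow>
     open D \<and> D \<noteq> {} \<and> bounded D \<and> lipschitz_boundary D \<and>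
     (\<exists>\<P>. finite \<P> \<and> (\<forall>P\<in>\<P>. polytope P) \<and> closure D = \<Union>\<P>)"

definition conforming_simplicial_mesh :: "'a::euclidean_space set set \<Rightarrow> 'a set \<Rightarrow> bool" where
  "conforming_simplicial_mesh \<T> \<Omega> \<longleftrightarrow>
     triangulation \<T> \<and> (\<forall>T\<in>\<T>. int DIM('a) simplex T) \<and> \<Union>\<T> = closure \<Omega>"

definition resolves_boundary :: "'a::euclidean_space set set \<Rightarrow> 'a set \<Rightarrow> bool" where
  "resolves_boundary \<T> D \<longleftrightarrow>
     (\<exists>\<F>. (\<forall>F\<in>\<F>. \<exists>T\<in>\<T>. F facet_of T) \<and> frontier D = \<Union>\<F>)"

definition overlapping_cover ::
    "'a::euclidean_space set set \<Rightarrow> 'a set \<Rightarrow> nat \<Rightarrow> (nat \<Rightarrow> 'a set) \<Rightarrow> bool" where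
  "overlapping_cover \<T> \<Omega> N \<Omega>s \<longleftrightarrow>
     (\<Union>j\<in>{1..N}. \<Omega>s j) = \<Omega> \<and>
     (\<forall>j\<in>{1..N}. lipschitz_polyhedral (\<Omega>s j) \<and> resolves_boundary \<T> (\<Omega>s j))"


subsection \<open>Surface measure\<close>

text \<open>The boundary integrals are taken with respect to the Hausdorff measure of dimension one less
  than the space, normalised to agree with Lebesgue measure on flat pieces. The outer measure is a metric outer
  measure, hence countably additive on Borel sets, so \<^const>\<open>measure_of\<close> does not collapse to the
  null measure.\<close>

definition hausdorff_size :: "nat \<Rightarrow> 'a::metric_space set \<Rightarrow> ennreal" where
  "hausdorff_size s U =
     (if U = {} then 0 else ennreal (unit_ball_vol (real s) * (diameter U / 2) ^ s))"

definition hausdorff_outer :: "nat \<Rightarrow> 'a::metric_space set \<Rightarrow> ennreal" where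
  "hausdorff_outer s A =
     (SUP \<delta>\<in>{0<..}. INF U\<in>{U :: nat \<Rightarrow> 'a set.
        A \<subseteq> (\<Union>i. U i) \<and> (\<forall>i. bounded (U i) \<and> diameter (U i) \<le> \<delta>)}. \<Sum>i. hausdorff_size s (U i))"

definition hausdorff_measure :: "nat \<Rightarrow> 'a::metric_space measure" where
  "hausdorff_measure s = completion (measure_of UNIV (sets borel) (hausdorff_outer s))"

definition surface_measure :: "'a::euclidean_space measure" where
  "surface_measure = hausdorff_measure (DIM('a) - 1)"

definition square_integrable_on :: "'a measure \<Rightarrow> 'a set \<Rightarrow> ('a \<Rightarrow> complex) \<Rightarrow> bool" where
  "square_integrable_on M A f \<longleftrightarrow>
     set_borel_measurable M A f \<and> set_integrable M A (\<lambda>x. (cmod (f x))\<^sup>2)"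


subsection \<open>The nodal finite element space\<close>

text \<open>Functions on a set \<open>S\<close> are total functions vanishing off \<open>S\<close>, so that equality of functions
  is equality on \<open>S\<close>. In particular \<open>restr S v\<close> stands for the restriction of \<open>v\<close> to \<open>S\<close>; it is not an
  extension by zero in the sense of function spaces on a larger domain.\<close>

definition restr :: "'a set \<Rightarrow> ('a \<Rightarrow> complex) \<Rightarrow> 'a \<Rightarrow> complex" where
  "restr S v = (\<lambda>x. if x \<in> S then v x else 0)"

definition polys :: "nat \<Rightarrow> (real^'n \<Rightarrow> complex) set" where
  "polys p = {q. \<exists>c :: ('n \<Rightarrow> nat) \<Rightarrow> complex. \<forall>x.
     q x = (\<Sum>\<alpha> | sum \<alpha> UNIV \<le> p. c \<alpha> * (\<Prod>i\<in>UNIV. of_real (x $ i) ^ \<alpha> i))}"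

definition fe_space :: "(real^'n) set \<Rightarrow> (real^'n) set set \<Rightarrow> nat \<Rightarrow> (real^'n \<Rightarrow> complex) set" where
  "fe_space \<Omega> \<T> p = {v. continuous_on (closure \<Omega>) v \<and> (\<forall>x. x \<notin> closure \<Omega> \<longrightarrow> v x = 0) \<and>
     (\<forall>T\<in>\<T>. \<exists>q\<in>polys p. \<forall>x\<in>T. v x = q x)}"

definition local_space ::
    "(real^'n) set \<Rightarrow> (real^'n) set set \<Rightarrow> nat \<Rightarrow> (real^'n) set \<Rightarrow> (real^'n \<Rightarrow> complex) set" where
  "local_space \<Omega> \<T> p D = restr (closure D) ` fe_space \<Omega> \<T> p"

text \<open>The nodes are the Lagrange nodes: the points of each simplex whose barycentric coordinates are
  multiples of \<open>1 / p\<close>.\<close>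

definition lagrange_nodes :: "nat \<Rightarrow> 'a::real_vector set \<Rightarrow> 'a set" where
  "lagrange_nodes p T = {x. \<exists>\<alpha> :: 'a \<Rightarrow> nat. (\<Sum>z | z extreme_point_of T. \<alpha> z) = p \<and>
     x = (\<Sum>z | z extreme_point_of T. (real (\<alpha> z) / real p) *\<^sub>R z)}"

definition fe_nodes :: "'a::real_vector set set \<Rightarrow> nat \<Rightarrow> 'a set" where
  "fe_nodes \<T> p = (\<Union>T\<in>\<T>. lagrange_nodes p T)"

definition zero_ext ::
    "(real^'n) set \<Rightarrow> (real^'n) set set \<Rightarrow> nat \<Rightarrow> (real^'n) set \<Rightarrow>
     (real^'n \<Rightarrow> complex) \<Rightarrow> real^'n \<Rightarrow> complex" where
  "zero_ext \<Omega> \<T> p D v = (THE w. w \<in> fe_space \<Omega> \<T> p \<and>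
     (\<forall>x\<in>fe_nodes \<T> p. w x = (if x \<in> closure D then v x else 0)))"

definition nodal_interp ::
    "(real^'n) set \<Rightarrow> (real^'n) set set \<Rightarrow> nat \<Rightarrow> (real^'n) set \<Rightarrow>
     (real^'n \<Rightarrow> complex) \<Rightarrow> real^'n \<Rightarrow> complex" where
  "nodal_interp \<Omega> \<T> p D v = (THE w. w \<in> local_space \<Omega> \<T> p D \<and>
     (\<forall>x\<in>fe_nodes \<T> p \<inter> closure D. w x = v x))"

definition weighted_ext ::
    "(real^'n) set \<Rightarrow> (real^'n) set set \<Rightarrow> nat \<Rightarrow> (real^'n) set \<Rightarrow> (real^'n \<Rightarrow> real) \<Rightarrow>
     (real^'n \<Rightarrow> complex) \<Rightarrow> real^'n \<Rightarrow> complex" where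
  "weighted_ext \<Omega> \<T> p D \<eta> v =
     zero_ext \<Omega> \<T> p D (nodal_interp \<Omega> \<T> p D (\<lambda>x. of_real (\<eta> x) * v x))"

definition partition_of_unity ::
    "'a::topological_space set \<Rightarrow> nat \<Rightarrow> (nat \<Rightarrow> 'a set) \<Rightarrow> (nat \<Rightarrow> 'a \<Rightarrow> real) \<Rightarrow> bool" where
  "partition_of_unity \<Omega> N \<Omega>s \<eta> \<longleftrightarrow>
     (\<forall>j\<in>{1..N}. closure {x \<in> closure \<Omega>. \<eta> j x \<noteq> 0} \<subseteq> closure (\<Omega>s j) \<and>
        (\<forall>x\<in>closure \<Omega>. 0 \<le> \<eta> j x \<and> \<eta> j x \<le> 1)) \<and>
     (\<forall>x\<in>closure \<Omega>. (\<Sum>j\<in>{1..N}. \<eta> j x) = 1)"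


subsection \<open>The Helmholtz forms\<close>

text \<open>The forms are only applied to continuous piecewise polynomials. Their weak gradient is the
  classical gradient, which exists off the null set of element boundaries, and their trace is the
  pointwise restriction. The integrals are with respect to the completed Lebesgue measure, so the
  arbitrary values of \<^const>\<open>frechet_derivative\<close> on that null set are irrelevant.\<close>

definition partial_deriv :: "'n \<Rightarrow> (real^'n \<Rightarrow> complex) \<Rightarrow> real^'n \<Rightarrow> complex" where
  "partial_deriv i v x = frechet_derivative v (at x) (axis i 1)"

definition sesq :: "real \<Rightarrow> (real^'n) set \<Rightarrow> (real^'n \<Rightarrow> complex) \<Rightarrow> (real^'n \<Rightarrow> complex) \<Rightarrow> complex" where
  "sesq k D v w =
     (LINT x:D|lebesgue. (\<Sum>i\<in>UNIV. partial_deriv i v x * cnj (partial_deriv i w x))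
        - (of_real k)\<^sup>2 * (v x * cnj (w x)))
     - \<i> * of_real k * (LINT x:frontier D|surface_measure. v x * cnj (w x))"

definition load ::
    "(real^'n) set \<Rightarrow> (real^'n \<Rightarrow> complex) \<Rightarrow> (real^'n \<Rightarrow> complex) \<Rightarrow> (real^'n \<Rightarrow> complex) \<Rightarrow> complex" where
  "load \<Omega> f g v = (LINT x:\<Omega>|lebesgue. f x * cnj (v x))
     + (LINT x:frontier \<Omega>|surface_measure. g x * cnj (v x))"

definition transfer_form ::
    "(real^'n) set \<Rightarrow> (real^'n) set set \<Rightarrow> nat \<Rightarrow> real \<Rightarrow> (real^'n) set \<Rightarrow>
     (real^'n \<Rightarrow> complex) \<Rightarrow> (real^'n \<Rightarrow> complex) \<Rightarrow> complex" where
  "transfer_form \<Omega> \<T> p k D w v = sesq k D w v - sesq k \<Omega> w (zero_ext \<Omega> \<T> p D v)"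


subsection \<open>Operators between the finite element spaces and their duals\<close>

text \<open>As the forms are antilinear in the second argument, the dual consists of the antilinear
  functionals (automatically continuous, since the spaces are finite-dimensional). Functionals on
  \<open>V\<close> are represented by functions vanishing off \<open>V\<close>.\<close>

definition antidual :: "('a \<Rightarrow> complex) set \<Rightarrow> (('a \<Rightarrow> complex) \<Rightarrow> complex) set" where
  "antidual V = {G. (\<forall>v\<in>V. \<forall>w\<in>V. G (\<lambda>x. v x + w x) = G v + G w) \<and>
     (\<forall>c. \<forall>v\<in>V. G (\<lambda>x. c * v x) = cnj c * G v) \<and> (\<forall>v. v \<notin> V \<longrightarrow> G v = 0)}"

definition functional_on ::
    "('a \<Rightarrow> complex) set \<Rightarrow> (('a \<Rightarrow> complex) \<Rightarrow> complex) \<Rightarrow> ('a \<Rightarrow> complex) \<Rightarrow> complex" where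
  "functional_on V G = (\<lambda>v. if v \<in> V then G v else 0)"

definition global_op ::
    "(real^'n) set \<Rightarrow> (real^'n) set set \<Rightarrow> nat \<Rightarrow> real \<Rightarrow>
     (real^'n \<Rightarrow> complex) \<Rightarrow> (real^'n \<Rightarrow> complex) \<Rightarrow> complex" where
  "global_op \<Omega> \<T> p k u = functional_on (fe_space \<Omega> \<T> p) (sesq k \<Omega> u)"

definition local_op ::
    "(real^'n) set \<Rightarrow> (real^'n) set set \<Rightarrow> nat \<Rightarrow> real \<Rightarrow> (real^'n) set \<Rightarrow>
     (real^'n \<Rightarrow> complex) \<Rightarrow> (real^'n \<Rightarrow> complex) \<Rightarrow> complex" where
  "local_op \<Omega> \<T> p k D u = functional_on (local_space \<Omega> \<T> p D) (sesq k D u)"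

definition load_op ::
    "(real^'n) set \<Rightarrow> (real^'n) set set \<Rightarrow> nat \<Rightarrow> (real^'n \<Rightarrow> complex) \<Rightarrow> (real^'n \<Rightarrow> complex) \<Rightarrow>
     (real^'n \<Rightarrow> complex) \<Rightarrow> complex" where
  "load_op \<Omega> \<T> p f g = functional_on (fe_space \<Omega> \<T> p) (load \<Omega> f g)"

definition restriction_op ::
    "(real^'n) set \<Rightarrow> (real^'n) set set \<Rightarrow> nat \<Rightarrow> (real^'n) set \<Rightarrow>
     ((real^'n \<Rightarrow> complex) \<Rightarrow> complex) \<Rightarrow> (real^'n \<Rightarrow> complex) \<Rightarrow> complex" where
  "restriction_op \<Omega> \<T> p D G =
     functional_on (local_space \<Omega> \<T> p D) (\<lambda>v. G (zero_ext \<Omega> \<T> p D v))"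

definition oras_prec ::
    "(real^'n) set \<Rightarrow> (real^'n) set set \<Rightarrow> nat \<Rightarrow> real \<Rightarrow> nat \<Rightarrow> (nat \<Rightarrow> (real^'n) set) \<Rightarrow>
     (nat \<Rightarrow> real^'n \<Rightarrow> real) \<Rightarrow> ((real^'n \<Rightarrow> complex) \<Rightarrow> complex) \<Rightarrow> real^'n \<Rightarrow> complex" where
  "oras_prec \<Omega> \<T> p k N \<Omega>s \<eta> G = (\<lambda>x. \<Sum>j\<in>{1..N}. weighted_ext \<Omega> \<T> p (\<Omega>s j) (\<eta> j)
     (inv_into (local_space \<Omega> \<T> p (\<Omega>s j)) (local_op \<Omega> \<T> p k (\<Omega>s j))
        (restriction_op \<Omega> \<T> p (\<Omega>s j) G)) x)"


subsection \<open>The two iterations\<close>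

definition local_solution ::
    "(real^'n) set \<Rightarrow> (real^'n) set set \<Rightarrow> nat \<Rightarrow> real \<Rightarrow> (real^'n \<Rightarrow> complex) \<Rightarrow> (real^'n \<Rightarrow> complex) \<Rightarrow>
     (real^'n) set \<Rightarrow> (real^'n \<Rightarrow> complex) \<Rightarrow> (real^'n \<Rightarrow> complex) \<Rightarrow> bool" where
  "local_solution \<Omega> \<T> p k f g D u s \<longleftrightarrow> s \<in> local_space \<Omega> \<T> p D \<and>
     (\<forall>v\<in>local_space \<Omega> \<T> p D.
        sesq k D s v = load \<Omega> f g (zero_ext \<Omega> \<T> p D v) + transfer_form \<Omega> \<T> p k D u v)"

primrec schwarz_iter ::
    "(real^'n) set \<Rightarrow> (real^'n) set set \<Rightarrow> nat \<Rightarrow> real \<Rightarrow> (real^'n \<Rightarrow> complex) \<Rightarrow> (real^'n \<Rightarrow> complex) \<Rightarrow>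
     nat \<Rightarrow> (nat \<Rightarrow> (real^'n) set) \<Rightarrow> (nat \<Rightarrow> real^'n \<Rightarrow> real) \<Rightarrow> (real^'n \<Rightarrow> complex) \<Rightarrow>
     nat \<Rightarrow> real^'n \<Rightarrow> complex" where
  "schwarz_iter \<Omega> \<T> p k f g N \<Omega>s \<eta> u0 0 = u0"
| "schwarz_iter \<Omega> \<T> p k f g N \<Omega>s \<eta> u0 (Suc n) =
     (\<lambda>x. \<Sum>l\<in>{1..N}. weighted_ext \<Omega> \<T> p (\<Omega>s l) (\<eta> l)
        (THE s. local_solution \<Omega> \<T> p k f g (\<Omega>s l) (schwarz_iter \<Omega> \<T> p k f g N \<Omega>s \<eta> u0 n) s) x)"

primrec richardson_iter ::
    "(real^'n) set \<Rightarrow> (real^'n) set set \<Rightarrow> nat \<Rightarrow> real \<Rightarrow> (real^'n \<Rightarrow> complex) \<Rightarrow> (real^'n \<Rightarrow> complex) \<Rightarrow>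
     nat \<Rightarrow> (nat \<Rightarrow> (real^'n) set) \<Rightarrow> (nat \<Rightarrow> real^'n \<Rightarrow> real) \<Rightarrow> (real^'n \<Rightarrow> complex) \<Rightarrow>
     nat \<Rightarrow> real^'n \<Rightarrow> complex" where
  "richardson_iter \<Omega> \<T> p k f g N \<Omega>s \<eta> u0 0 = u0"
| "richardson_iter \<Omega> \<T> p k f g N \<Omega>s \<eta> u0 (Suc n) =
     (let u = richardson_iter \<Omega> \<T> p k f g N \<Omega>s \<eta> u0 n in
      (\<lambda>x. u x + oras_prec \<Omega> \<T> p k N \<Omega>s \<eta>
        (\<lambda>v. load_op \<Omega> \<T> p f g v - global_op \<Omega> \<T> p k u v) x))"

end

theory Submission
  imports Defs
begin

text \<open>
  Let \<open>u\<close> be the current iterate, \<open>D\<close> a subdomain and \<open>E\<close> the zero nodal extension from \<open>D\<close>. The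
  Schwarz method solves \<open>a\<^sub>D(s, v) = F(E v) + a\<^sub>D(u, v) - a(u, E v)\<close> for \<open>s\<close>. If \<open>s\<close> is written as the
  restriction of \<open>u\<close> plus a correction \<open>c\<close>, then \<open>a\<^sub>D(u, v)\<close> cancels, and what remains,
  \<open>a\<^sub>D(c, v) = F(E v) - a(u, E v)\<close>, says that \<open>c\<close> is the local inverse applied to the restricted residual, which
  is the contribution of \<open>D\<close> to the ORAS preconditioner (\<open>local_solution_correction\<close>). After
  the weighted extension the restrictions of \<open>u\<close> add up to \<open>u\<close>, because the weights form a partition of unity
  at the nodes (\<open>sum_weighted_ext\<close>). So one Schwarz step is one Richardson step, and induction on the
  number of steps finishes the proof.

  The work lies in two facts which the argument takes for granted.

  First, extension and interpolation must be well defined and linear, which requires the Lagrange nodes to be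
  unisolvent. With \<open>\<lambda>\<^sub>z\<close> the hat function of the vertex \<open>z\<close>, the basis function of the multi-index
  \<open>\<alpha>\<close> is the product of the binomials of \<open>p \<lambda>\<^sub>z\<close> over \<open>\<alpha> z\<close>. It is globally continuous since the
  \<open>\<lambda>\<^sub>z\<close> are (\<open>fe_space_interpolation_exists\<close>). Conversely, the recursion
  \<open>t (t gchoose k) = k (t gchoose k) + (k + 1) (t gchoose (k + 1))\<close> and the identity
  \<open>\<Sum>\<^sub>z \<lambda>\<^sub>z = 1\<close> show that on a simplex these functions span all polynomials of degree at most \<open>p\<close>
  (\<open>polys_in_basis_span\<close>), so that a polynomial is determined by its nodal values
  (\<open>polys_unisolvent\<close>). For the interpolation on a subdomain one also needs that its closure is a union of
  mesh simplices (\<open>resolved_closure_is_union_of_cells\<close>).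

  Second, the forms must be additive, that is, all the integrals must exist. The volume terms are bounded and
  piecewise continuous (\<open>volume_integrand_integrable\<close>). The boundary terms are products of a square
  integrable and a bounded function, so it suffices that the boundary has finite surface measure. This holds because it is
  locally a Lipschitz image of a piece of a hyperplane (\<open>finite_content_frontier\<close>).
\<close>

section \<open>Polynomials of bounded total degree\<close>

lemma finite_multi_indices: "finite {\<alpha> :: 'n::finite \<Rightarrow> nat. sum \<alpha> UNIV \<le> p}"
proof (rule finite_subset)
  show "{\<alpha> :: 'n \<Rightarrow> nat. sum \<alpha> UNIV \<le> p} \<subseteq> PiE UNIV (\<lambda>_. {..p})"
  proof safe
    fix \<alpha> :: "'n \<Rightarrow> nat" and i
    assume "sum \<alpha> UNIV \<le> p"
    moreover have "\<alpha> i \<le> sum \<alpha> UNIV" by (rule member_le_sum) auto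
    ultimately show "\<alpha> i \<le> p" by simp
  qed auto
  show "finite (PiE UNIV (\<lambda>_::'n. {..p}))" by (rule finite_PiE) auto
qed

lemma polys_add:
  fixes q r :: "real^'n \<Rightarrow> complex"
  assumes "q \<in> polys p" "r \<in> polys p"
  shows "(\<lambda>x. q x + r x) \<in> polys p"
proof -
  obtain c d where
    "\<And>x. q x = (\<Sum>\<alpha> | sum \<alpha> UNIV \<le> p. c \<alpha> * (\<Prod>i\<in>UNIV. of_real (x $ i) ^ \<alpha> i))"
    "\<And>x. r x = (\<Sum>\<alpha> | sum \<alpha> UNIV \<le> p. d \<alpha> * (\<Prod>i\<in>UNIV. of_real (x $ i) ^ \<alpha> i))"
    using assms unfolding polys_def by blast
  then have "\<And>x. q x + r x =
      (\<Sum>\<alpha> | sum \<alpha> UNIV \<le> p. (c \<alpha> + d \<alpha>) * (\<Prod>i\<in>UNIV. of_real (x $ i) ^ \<alpha> i))"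
    by (simp add: sum.distrib distrib_right)
  then show ?thesis unfolding polys_def by (intro CollectI exI allI)
qed

lemma polys_scale:
  fixes q :: "real^'n \<Rightarrow> complex"
  assumes "q \<in> polys p"
  shows "(\<lambda>x. b * q x) \<in> polys p"
proof -
  obtain c where
    "\<And>x. q x = (\<Sum>\<alpha> | sum \<alpha> UNIV \<le> p. c \<alpha> * (\<Prod>i\<in>UNIV. of_real (x $ i) ^ \<alpha> i))"
    using assms unfolding polys_def by blast
  then have "\<And>x. b * q x =
      (\<Sum>\<alpha> | sum \<alpha> UNIV \<le> p. (b * c \<alpha>) * (\<Prod>i\<in>UNIV. of_real (x $ i) ^ \<alpha> i))"
    by (simp add: sum_distrib_left mult.assoc)
  then show ?thesis unfolding polys_def by (intro CollectI exI allI)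
qed

lemma polys_monomial:
  fixes \<alpha> :: "'n::finite \<Rightarrow> nat"
  assumes "sum \<alpha> UNIV \<le> p"
  shows "(\<lambda>x::real^'n. \<Prod>i\<in>UNIV. of_real (x $ i) ^ \<alpha> i :: complex) \<in> polys p"
proof -
  have "\<forall>x::real^'n. (\<Prod>i\<in>UNIV. of_real (x $ i) ^ \<alpha> i :: complex) =
    (\<Sum>\<beta> | sum \<beta> UNIV \<le> p. (if \<beta> = \<alpha> then 1 else 0) * (\<Prod>i\<in>UNIV. of_real (x $ i) ^ \<beta> i))"
    using assms finite_multi_indices[where 'n='n, of p]
    by (simp add: if_distrib[of "\<lambda>c. c * _"] sum.delta cong: if_cong)
  then show ?thesis
    unfolding polys_def by (intro CollectI exI[where x = "\<lambda>\<beta>. if \<beta> = \<alpha> then 1 else 0"])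
qed

lemma polys_const: "(\<lambda>x::real^'n. c) \<in> polys p"
proof -
  have "(\<lambda>x::real^'n. c * (\<Prod>i\<in>UNIV. of_real (x $ i) ^ (\<lambda>_. 0) i)) \<in> polys p"
    by (intro polys_scale polys_monomial) simp
  then show ?thesis by simp
qed

lemma polys_sum:
  fixes q :: "'i \<Rightarrow> real^'n \<Rightarrow> complex"
  assumes "\<And>i. i \<in> I \<Longrightarrow> q i \<in> polys p"
  shows "(\<lambda>x. \<Sum>i\<in>I. q i x) \<in> polys p"
  using assms
  by (induction I rule: infinite_finite_induct) (simp_all add: polys_const polys_add)

lemma multi_index_Suc:
  fixes \<alpha> :: "'n::finite \<Rightarrow> nat"
  assumes "sum \<alpha> UNIV = Suc m"
  obtains i \<beta> where "\<alpha> = \<beta>(i := Suc (\<beta> i))" "sum \<beta> UNIV = m"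
proof -
  obtain i where i: "\<alpha> i \<noteq> 0" using assms by (metis nat.distinct(1) sum.neutral)
  define \<beta> where "\<beta> = \<alpha>(i := \<alpha> i - 1)"
  have "\<alpha> = \<beta>(i := Suc (\<beta> i))" using i by (auto simp: \<beta>_def fun_eq_iff)
  moreover have "sum \<beta> UNIV = m"
  proof -
    have "sum \<alpha> UNIV = \<alpha> i + sum \<alpha> (UNIV - {i})" by (simp add: sum.remove[of _ i])
    moreover have "sum \<beta> UNIV = \<beta> i + sum \<beta> (UNIV - {i})" by (simp add: sum.remove[of _ i])
    moreover have "sum \<beta> (UNIV - {i}) = sum \<alpha> (UNIV - {i})"
      by (rule sum.cong) (auto simp: \<beta>_def)
    ultimately show ?thesis using assms i by (simp add: \<beta>_def)
  qed
  ultimately show ?thesis using that by blast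
qed

lemma monomial_increment:
  fixes x :: "real^'n::finite"
  shows "(\<Prod>l\<in>UNIV. of_real (x $ l) ^ (\<beta>(i := Suc (\<beta> i))) l :: complex) =
    of_real (x $ i) * (\<Prod>l\<in>UNIV. of_real (x $ l) ^ \<beta> l)"
proof -
  have "(\<Prod>l\<in>UNIV - {i}. of_real (x $ l) ^ (\<beta>(i := Suc (\<beta> i))) l :: complex) =
      (\<Prod>l\<in>UNIV - {i}. of_real (x $ l) ^ \<beta> l)"
    by (rule prod.cong) auto
  then show ?thesis by (simp add: prod.remove[of UNIV i])
qed

text \<open>An induction principle for polynomials: every monomial is reached from a constant by multiplying with
  one coordinate at a time, and the level of the filtration keeps track of the number of factors.\<close>

lemma polys_subset_filtration:
  fixes K :: "nat \<Rightarrow> (real^'n::finite \<Rightarrow> complex) set"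
  assumes const: "\<And>c. (\<lambda>x. c) \<in> K 0"
    and add: "\<And>m h h'. m \<le> p \<Longrightarrow> h \<in> K m \<Longrightarrow> h' \<in> K m \<Longrightarrow> (\<lambda>x. h x + h' x) \<in> K m"
    and scale: "\<And>m c h. m \<le> p \<Longrightarrow> h \<in> K m \<Longrightarrow> (\<lambda>x. c * h x) \<in> K m"
    and mono: "\<And>m. m < p \<Longrightarrow> K m \<subseteq> K (Suc m)"
    and coord: "\<And>m i h. m < p \<Longrightarrow> h \<in> K m \<Longrightarrow> (\<lambda>x. of_real (x $ i) * h x) \<in> K (Suc m)"
  shows "polys p \<subseteq> K p"
proof
  fix q :: "real^'n \<Rightarrow> complex" assume "q \<in> polys p"
  then obtain c where
    q: "\<And>x. q x = (\<Sum>\<alpha> | sum \<alpha> UNIV \<le> p. c \<alpha> * (\<Prod>i\<in>UNIV. of_real (x $ i) ^ \<alpha> i))"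
    unfolding polys_def by blast
  have mono': "m \<le> n \<Longrightarrow> n \<le> p \<Longrightarrow> K m \<subseteq> K n" for m n
  proof (induction n)
    case (Suc n)
    then show ?case using mono[of n] by (cases "m = Suc n") auto
  qed simp
  have monomial: "m \<le> p \<Longrightarrow> sum \<alpha> UNIV = m \<Longrightarrow>
      (\<lambda>x. \<Prod>i\<in>UNIV. of_real (x $ i) ^ \<alpha> i) \<in> K m" for m and \<alpha> :: "'n \<Rightarrow> nat"
  proof (induction m arbitrary: \<alpha>)
    case 0
    then show ?case using const by simp
  next
    case (Suc m)
    obtain i \<beta> where \<alpha>: "\<alpha> = \<beta>(i := Suc (\<beta> i))" and \<beta>: "sum \<beta> UNIV = m"
      using multi_index_Suc[OF Suc.prems(2)] .
    show ?case unfolding \<alpha> monomial_increment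
      using coord[of m "\<lambda>x. \<Prod>l\<in>UNIV. of_real (x $ l) ^ \<beta> l" i] Suc.IH[OF _ \<beta>] Suc.prems by simp
  qed
  have sum_K: "(\<And>i. i \<in> I \<Longrightarrow> h i \<in> K p) \<Longrightarrow> (\<lambda>x. \<Sum>i\<in>I. h i x) \<in> K p"
    for I :: "('n \<Rightarrow> nat) set" and h :: "('n \<Rightarrow> nat) \<Rightarrow> real^'n \<Rightarrow> complex"
  proof (induction I rule: infinite_finite_induct)
    case (insert i I)
    then show ?case using add[of p "h i" "\<lambda>x. \<Sum>i\<in>I. h i x"] by simp
  qed (use const[of 0] mono'[of 0 p] in auto)
  have "(\<lambda>x. \<Sum>\<alpha> | sum \<alpha> UNIV \<le> p. c \<alpha> * (\<Prod>i\<in>UNIV. of_real (x $ i) ^ \<alpha> i)) \<in> K p"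
  proof (rule sum_K)
    fix \<alpha> :: "'n \<Rightarrow> nat" assume "\<alpha> \<in> {\<alpha>. sum \<alpha> UNIV \<le> p}"
    then show "(\<lambda>x. c \<alpha> * (\<Prod>i\<in>UNIV. of_real (x $ i) ^ \<alpha> i)) \<in> K p"
      using monomial[of "sum \<alpha> UNIV" \<alpha>] mono'[of "sum \<alpha> UNIV" p] by (intro scale) auto
  qed
  moreover have "q = (\<lambda>x. \<Sum>\<alpha> | sum \<alpha> UNIV \<le> p. c \<alpha> * (\<Prod>i\<in>UNIV. of_real (x $ i) ^ \<alpha> i))"
    using q by blast
  ultimately show "q \<in> K p" by simp
qed

lemma polys_coord_mult:
  fixes q :: "real^'n::finite \<Rightarrow> complex"
  assumes "q \<in> polys p"
  shows "(\<lambda>x. of_real (x $ i) * q x) \<in> polys (Suc p)"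
proof -
  let ?I = "{\<alpha> :: 'n \<Rightarrow> nat. sum \<alpha> UNIV \<le> p}"
  obtain c where q: "\<And>x. q x = (\<Sum>\<alpha>\<in>?I. c \<alpha> * (\<Prod>i\<in>UNIV. of_real (x $ i) ^ \<alpha> i))"
    using assms unfolding polys_def by blast
  have "(\<lambda>x. \<Sum>\<alpha>\<in>?I. c \<alpha> * (\<Prod>l\<in>UNIV. of_real (x $ l) ^ (\<alpha>(i := Suc (\<alpha> i))) l)) \<in> polys (Suc p)"
  proof (intro polys_sum polys_scale polys_monomial)
    fix \<alpha> :: "'n \<Rightarrow> nat" assume "\<alpha> \<in> ?I"
    moreover have "sum (\<alpha>(i := Suc (\<alpha> i))) (UNIV - {i}) = sum \<alpha> (UNIV - {i})"
      by (rule sum.cong) auto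
    ultimately show "sum (\<alpha>(i := Suc (\<alpha> i))) UNIV \<le> Suc p"
      by (simp add: sum.remove[of UNIV i])
  qed
  moreover have "(\<lambda>x. of_real (x $ i) * q x) =
      (\<lambda>x. \<Sum>\<alpha>\<in>?I. c \<alpha> * (\<Prod>l\<in>UNIV. of_real (x $ l) ^ (\<alpha>(i := Suc (\<alpha> i))) l))"
    unfolding monomial_increment by (simp add: q sum_distrib_left mult.left_commute)
  ultimately show ?thesis by (simp only:)
qed

lemma polys_Suc: "polys p \<subseteq> polys (Suc p)"
proof
  fix q :: "real^'n \<Rightarrow> complex" assume "q \<in> polys p"
  then obtain c where
    q: "\<And>x. q x = (\<Sum>\<alpha> | sum \<alpha> UNIV \<le> p. c \<alpha> * (\<Prod>i\<in>UNIV. of_real (x $ i) ^ \<alpha> i))"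
    unfolding polys_def by blast
  have "(\<lambda>x. \<Sum>\<alpha> | sum \<alpha> UNIV \<le> p. c \<alpha> * (\<Prod>i\<in>UNIV. of_real (x $ i) ^ \<alpha> i))
      \<in> polys (Suc p)"
    by (intro polys_sum polys_scale polys_monomial) simp
  moreover have "q = (\<lambda>x. \<Sum>\<alpha> | sum \<alpha> UNIV \<le> p. c \<alpha> * (\<Prod>i\<in>UNIV. of_real (x $ i) ^ \<alpha> i))"
    using q by blast
  ultimately show "q \<in> polys (Suc p)" by (simp only:)
qed

lemma polys_affine_mult:
  fixes q :: "real^'n::finite \<Rightarrow> complex"
  assumes "q \<in> polys p"
  shows "(\<lambda>x. of_real (a \<bullet> x + b) * q x) \<in> polys (Suc p)"
proof -
  have "(\<lambda>x. (\<Sum>i\<in>UNIV. of_real (a $ i) * (of_real (x $ i) * q x)) + of_real b * q x)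
      \<in> polys (Suc p)"
    using assms polys_Suc by (intro polys_add polys_sum polys_scale polys_coord_mult) auto
  then show ?thesis
    by (simp add: inner_vec_def sum_distrib_right distrib_right mult.assoc)
qed

text \<open>The generalised binomial of an affine function over \<open>k\<close> is a product of \<open>k\<close> affine factors, hence a
  polynomial of degree at most \<open>k\<close>. This is what bounds the degree of the Lagrange basis functions.\<close>

lemma polys_affine_gbinomial_mult:
  fixes q :: "real^'n::finite \<Rightarrow> complex"
  assumes "q \<in> polys p"
  shows "(\<lambda>x. of_real ((a \<bullet> x + b) gchoose k) * q x) \<in> polys (p + k)"
proof (induction k)
  case 0
  then show ?case using assms by simp
next
  case (Suc k)
  have step: "((t::real) gchoose Suc k) = (1 / real (Suc k)) * ((t - real k) * (t gchoose k))" for t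
    using gbinomial_mult_1[of t k] by (simp add: field_simps)
  have "(\<lambda>x. of_real (1 / real (Suc k)) *
      (of_real (a \<bullet> x + (b - real k)) * (of_real ((a \<bullet> x + b) gchoose k) * q x)))
      \<in> polys (Suc (p + k))"
    by (intro polys_scale polys_affine_mult Suc.IH)
  moreover have "(\<lambda>x. of_real (1 / real (Suc k)) *
      (of_real (a \<bullet> x + (b - real k)) * (of_real ((a \<bullet> x + b) gchoose k) * q x))) =
      (\<lambda>x. of_real ((a \<bullet> x + b) gchoose Suc k) * q x)"
    unfolding step of_real_mult by (simp add: algebra_simps)
  ultimately show ?case by simp
qed

lemma polys_prod_affine_gbinomial:
  fixes a :: "'z \<Rightarrow> real^'n::finite"
  assumes "finite Z"
  shows "(\<lambda>x. of_real (\<Prod>z\<in>Z. (a z \<bullet> x + b z) gchoose k z)) \<in> polys (sum k Z)"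
  using assms
proof (induction Z)
  case (insert z Z)
  have "(\<lambda>x. of_real ((a z \<bullet> x + b z) gchoose k z) *
      of_real (\<Prod>z\<in>Z. (a z \<bullet> x + b z) gchoose k z)) \<in> polys (sum k Z + k z)"
    by (rule polys_affine_gbinomial_mult[OF insert.IH])
  then show ?case using insert.hyps by (simp add: add.commute)
qed (simp add: polys_const)

definition has_continuous_partials :: "(real^'n \<Rightarrow> complex) \<Rightarrow> bool" where
  "has_continuous_partials q \<longleftrightarrow>
     (\<forall>x. q differentiable (at x)) \<and> (\<forall>i. continuous_on UNIV (partial_deriv i q))"

lemma partial_deriv_add:
  assumes "v differentiable (at x)" "w differentiable (at x)"
  shows "partial_deriv i (\<lambda>x. v x + w x) x = partial_deriv i v x + partial_deriv i w x"
proof -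
  have "((\<lambda>x. v x + w x) has_derivative
      (\<lambda>y. frechet_derivative v (at x) y + frechet_derivative w (at x) y)) (at x)"
    using assms by (intro has_derivative_add) (simp_all add: frechet_derivative_works)
  from frechet_derivative_at[OF this, symmetric] show ?thesis by (simp add: partial_deriv_def)
qed

lemma partial_deriv_scale:
  assumes "v differentiable (at x)"
  shows "partial_deriv i (\<lambda>x. c * v x) x = c * partial_deriv i v x"
proof -
  have "((\<lambda>x. c * v x) has_derivative (\<lambda>y. c * frechet_derivative v (at x) y)) (at x)"
    using assms by (intro has_derivative_mult_right) (simp add: frechet_derivative_works)
  from frechet_derivative_at[OF this, symmetric] show ?thesis by (simp add: partial_deriv_def)
qed

lemma polys_has_continuous_partials:
  fixes q :: "real^'n::finite \<Rightarrow> complex"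
  assumes "q \<in> polys p"
  shows "has_continuous_partials q"
proof -
  let ?K = "\<lambda>_::nat. Collect (has_continuous_partials :: (real^'n \<Rightarrow> complex) \<Rightarrow> bool)"
  have add: "has_continuous_partials (\<lambda>x. h x + h' x)"
    if "has_continuous_partials h" "has_continuous_partials h'" for h h' :: "real^'n \<Rightarrow> complex"
  proof -
    have "partial_deriv i (\<lambda>x. h x + h' x) = (\<lambda>x. partial_deriv i h x + partial_deriv i h' x)" for i
      using that by (intro ext partial_deriv_add) (auto simp: has_continuous_partials_def)
    then show ?thesis using that
      by (auto simp: has_continuous_partials_def intro!: derivative_intros continuous_intros)
  qed
  have mult: "has_continuous_partials (\<lambda>x. h x * h' x)"
    if "has_continuous_partials h" "has_continuous_partials h'" for h h' :: "real^'n \<Rightarrow> complex"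
  proof -
    have D: "\<And>x. h differentiable (at x)" "\<And>x. h' differentiable (at x)"
      using that by (auto simp: has_continuous_partials_def)
    have "partial_deriv i (\<lambda>x. h x * h' x) =
        (\<lambda>x. h x * partial_deriv i h' x + partial_deriv i h x * h' x)" for i
    proof
      fix x
      have "((\<lambda>x. h x * h' x) has_derivative
          (\<lambda>y. h x * frechet_derivative h' (at x) y + frechet_derivative h (at x) y * h' x)) (at x)"
        using D[of x] by (intro has_derivative_mult) (simp_all add: frechet_derivative_works)
      from frechet_derivative_at[OF this, symmetric]
      show "partial_deriv i (\<lambda>x. h x * h' x) x = h x * partial_deriv i h' x + partial_deriv i h x * h' x"
        by (simp add: partial_deriv_def)
    qed
    moreover have "continuous_on UNIV h" "continuous_on UNIV h'"
      using D by (auto intro!: differentiable_imp_continuous_on simp: differentiable_on_def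
          differentiable_at_withinI)
    ultimately show ?thesis using that D
      by (auto simp: has_continuous_partials_def intro!: derivative_intros continuous_intros)
  qed
  have const: "has_continuous_partials (\<lambda>x. c)" for c
    by (simp add: has_continuous_partials_def partial_deriv_def)
  have coord: "has_continuous_partials (\<lambda>x::real^'n. of_real (x $ i))" for i
  proof -
    have "((\<lambda>x::real^'n. of_real (x $ i) :: complex) has_derivative (\<lambda>y. of_real (y $ i))) (at x)" for x
      by (intro bounded_linear_imp_has_derivative bounded_linear_compose[OF bounded_linear_of_real]
          bounded_linear_vec_nth)
    then have "frechet_derivative (\<lambda>x::real^'n. of_real (x $ i) :: complex) (at x) = (\<lambda>y. of_real (y $ i))"
      "(\<lambda>x::real^'n. of_real (x $ i) :: complex) differentiable (at x)" for x
      using frechet_derivative_at by (metis, auto simp: differentiable_def)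
    then show ?thesis by (simp add: has_continuous_partials_def partial_deriv_def)
  qed
  have "polys p \<subseteq> ?K p"
    by (rule polys_subset_filtration) (auto intro: add mult const coord)
  then show ?thesis using assms by blast
qed

lemma polys_continuous_on:
  fixes q :: "real^'n::finite \<Rightarrow> complex"
  assumes "q \<in> polys p"
  shows "continuous_on S q"
proof -
  have "isCont q x" for x
    using polys_has_continuous_partials[OF assms]
    by (intro differentiable_imp_continuous_within) (simp add: has_continuous_partials_def)
  then show ?thesis by (simp add: continuous_at_imp_continuous_on)
qed

section \<open>Barycentric coordinates on a mesh\<close>

text \<open>Affine independence makes the edge vectors from a vertex \<open>z0\<close> linearly independent, so a linear
  functional can be prescribed on them. This yields uniqueness of barycentric coordinates, their
  continuity and their polynomial degree all at once.\<close>

lemma barycentric_coordinate_affine: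
  fixes C :: "'a::euclidean_space set"
  assumes "\<not> affine_dependent C" "z \<in> C"
  obtains a b where "\<And>u. sum u C = 1 \<Longrightarrow> a \<bullet> (\<Sum>w\<in>C. u w *\<^sub>R w) + b = u z"
proof (cases "C = {z}")
  case True
  then show ?thesis using that[of 0 1] by simp
next
  case False
  then obtain z0 where z0: "z0 \<in> C" "z0 \<noteq> z" using assms by blast
  have fin: "finite C" using assms aff_independent_finite by blast
  have "independent ((\<lambda>x. x - z0) ` (C - {z0}))"
    using affine_dependent_iff_dependent2[OF z0(1)] assms(1) by (simp add: image_def)
  from linear_independent_extend[OF this, of "\<lambda>v. if v = z - z0 then 1 else 0 :: real"]
  obtain g where g: "linear g"
    "\<And>w. w \<in> C - {z0} \<Longrightarrow> g (w - z0) = (if w = z then 1 else 0 :: real)" by auto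
  define a where "a = adjoint g 1"
  have a: "a \<bullet> x = g x" for x
    using adjoint_works[OF g(1), of x 1] by (simp add: a_def inner_commute)
  have "a \<bullet> (\<Sum>w\<in>C. u w *\<^sub>R w) + - g z0 = u z" if u: "sum u C = 1" for u
  proof -
    have "(\<Sum>w\<in>C. u w *\<^sub>R w) - z0 = (\<Sum>w\<in>C. u w *\<^sub>R (w - z0))"
      using u by (simp add: scaleR_diff_right sum_subtractf flip: scaleR_left.sum)
    then have "a \<bullet> (\<Sum>w\<in>C. u w *\<^sub>R w) + - g z0 = g (\<Sum>w\<in>C. u w *\<^sub>R (w - z0))"
      by (simp add: a flip: linear_diff[OF g(1)])
    also have "\<dots> = (\<Sum>w\<in>C. u w * g (w - z0))"
      using g(1) by (simp add: linear_sum linear_cmul)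
    also have "\<dots> = (\<Sum>w\<in>C. if w = z then u w else 0)"
    proof (rule sum.cong[OF refl])
      fix w assume "w \<in> C"
      then show "u w * g (w - z0) = (if w = z then u w else 0)"
        using g(2)[of w] linear_0[OF g(1)] z0 by (cases "w = z0") auto
    qed
    also have "\<dots> = u z" using fin assms by simp
    finally show ?thesis .
  qed
  then show ?thesis using that by blast
qed

definition verts :: "'a::real_vector set \<Rightarrow> 'a set" where
  "verts T = {z. z extreme_point_of T}"

lemma simplex_verts:
  fixes T :: "'a::euclidean_space set"
  assumes "n simplex T"
  shows "finite (verts T)" "\<not> affine_dependent (verts T)" "T = convex hull verts T"
proof -
  obtain C where C: "\<not> affine_dependent C" "T = convex hull C"
    using assms unfolding simplex_def by blast
  then have "verts T = C" by (auto simp: verts_def extreme_point_of_convex_hull_affine_independent)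
  then show "finite (verts T)" "\<not> affine_dependent (verts T)" "T = convex hull verts T"
    using C aff_independent_finite by auto
qed

text \<open>The coordinates are total functions that vanish off \<open>C\<close>, so that coordinates with respect to
  different simplices can be compared by plain equality.\<close>

definition barycentric :: "'a::real_vector set \<Rightarrow> ('a \<Rightarrow> real) \<Rightarrow> 'a \<Rightarrow> bool" where
  "barycentric C u x \<longleftrightarrow> (\<forall>z. z \<notin> C \<longrightarrow> u z = 0) \<and> (\<forall>z. 0 \<le> u z) \<and> sum u C = 1 \<and>
     (\<Sum>z\<in>C. u z *\<^sub>R z) = x"

lemma barycentric_exists:
  assumes "finite C" "x \<in> convex hull C"
  obtains u where "barycentric C u x"
proof -
  obtain u where u: "\<forall>z\<in>C. 0 \<le> u z" "sum u C = 1" "(\<Sum>z\<in>C. u z *\<^sub>R z) = x"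
    using assms by (auto simp: convex_hull_finite)
  have "barycentric C (\<lambda>z. if z \<in> C then u z else 0) x"
    using u by (auto simp: barycentric_def)
  then show ?thesis using that by blast
qed

lemma barycentric_in_hull:
  assumes "finite C" "barycentric C u x"
  shows "x \<in> convex hull C"
proof -
  have "\<forall>z\<in>C. 0 \<le> u z" "sum u C = 1" "(\<Sum>z\<in>C. u z *\<^sub>R z) = x"
    using assms by (auto simp: barycentric_def)
  then show ?thesis unfolding convex_hull_finite[OF assms(1)] by blast
qed

lemma barycentric_mono:
  assumes "barycentric C u x" "C \<subseteq> C'" "finite C'"
  shows "barycentric C' u x"
proof -
  have "sum u C' = sum u C" "(\<Sum>z\<in>C'. u z *\<^sub>R z) = (\<Sum>z\<in>C. u z *\<^sub>R z)"
    using assms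
    by (intro sum.mono_neutral_right; force simp: barycentric_def)+
  moreover have "\<forall>z. z \<notin> C' \<longrightarrow> u z = 0" "\<forall>z. 0 \<le> u z" "sum u C = 1" "(\<Sum>z\<in>C. u z *\<^sub>R z) = x"
    using assms by (auto simp: barycentric_def)
  ultimately show ?thesis by (simp add: barycentric_def)
qed

lemma barycentric_unique:
  fixes C :: "'a::euclidean_space set"
  assumes "\<not> affine_dependent C" "barycentric C u x" "barycentric C u' x"
  shows "u = u'"
proof
  fix z
  show "u z = u' z"
  proof (cases "z \<in> C")
    case True
    obtain a b where "\<And>u. sum u C = 1 \<Longrightarrow> a \<bullet> (\<Sum>w\<in>C. u w *\<^sub>R w) + b = u z"
      using barycentric_coordinate_affine[OF assms(1) True] by blast
    then show ?thesis using assms(2,3) unfolding barycentric_def by metis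
  qed (use assms in \<open>auto simp: barycentric_def\<close>)
qed

text \<open>The hat function of \<open>z\<close> is defined through any simplex that contains the point. Two such simplices give
  the same value, because the point lies in a common face, whose vertices carry its coordinates
  in both.\<close>

definition hat :: "'a::euclidean_space set set \<Rightarrow> 'a \<Rightarrow> 'a \<Rightarrow> real" where
  "hat \<T> z x = (THE u. \<exists>T\<in>\<T>. barycentric (verts T) u x) z"

locale simplicial_mesh =
  fixes \<T> :: "(real^'n::finite) set set" and p :: nat
  assumes triangulation: "triangulation \<T>"
    and full_simplex: "\<And>T. T \<in> \<T> \<Longrightarrow> int DIM(real^'n) simplex T"
    and degree: "p \<ge> 1"
begin

lemma finite_mesh: "finite \<T>"
  using triangulation by (simp add: triangulation_def)

lemma finite_verts: "T \<in> \<T> \<Longrightarrow> finite (verts T)"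
  using simplex_verts full_simplex by blast

lemma compact_cell: "T \<in> \<T> \<Longrightarrow> compact T"
  using simplex_verts(1,3)[OF full_simplex] by (metis finite_imp_compact_convex_hull)

lemma convex_cell: "T \<in> \<T> \<Longrightarrow> convex T"
  using simplex_verts(3)[OF full_simplex] by (metis convex_convex_hull)

lemma face_cell: "T \<in> \<T> \<Longrightarrow> T' \<in> \<T> \<Longrightarrow> (T \<inter> T') face_of T"
  using triangulation by (simp add: triangulation_def)

lemma barycentric_mesh_unique:
  assumes "T \<in> \<T>" "T' \<in> \<T>" "barycentric (verts T) u x" "barycentric (verts T') u' x"
  shows "u = u'"
proof -
  have sub: "verts (S \<inter> S') \<subseteq> verts S" if "S \<in> \<T>" "S' \<in> \<T>" for S S'
    using extreme_point_of_face[OF face_cell[OF that]] by (auto simp: verts_def)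
  have hull: "x \<in> S" if "S \<in> \<T>" "barycentric (verts S) v x" for S v
  proof -
    have "x \<in> convex hull verts S"
      using barycentric_in_hull[OF finite_verts[OF that(1)] that(2)] .
    then show ?thesis using simplex_verts(3)[OF full_simplex[OF that(1)]] by simp
  qed
  let ?F = "T \<inter> T'"
  have "x \<in> ?F" using hull assms by blast
  moreover have "compact ?F" "convex ?F"
    using assms compact_cell convex_cell by (auto intro: compact_Int convex_Int)
  then have "?F = convex hull verts ?F"
    unfolding verts_def by (rule Krein_Milman_Minkowski)
  ultimately have "x \<in> convex hull verts ?F" by simp
  moreover have "finite (verts ?F)"
    using sub[OF assms(1,2)] finite_verts[OF assms(1)] finite_subset by blast
  ultimately obtain w where w: "barycentric (verts ?F) w x"
    using barycentric_exists by blast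
  have "barycentric (verts T) w x"
    using barycentric_mono[OF w] sub assms(1,2) finite_verts by blast
  moreover have "barycentric (verts T') w x"
    using barycentric_mono[OF w, of "verts T'"] sub[of T' T] assms(1,2) finite_verts
    by (simp add: Int_commute)
  ultimately show ?thesis
    using barycentric_unique[OF simplex_verts(2)[OF full_simplex]] assms by metis
qed

lemma hat_eq:
  assumes "T \<in> \<T>" "barycentric (verts T) u x"
  shows "hat \<T> z x = u z"
proof -
  have "(THE u. \<exists>T\<in>\<T>. barycentric (verts T) u x) = u"
    using assms barycentric_mesh_unique by (intro the_equality) blast+
  then show ?thesis by (simp add: hat_def)
qed

lemma barycentric_hat:
  assumes "T \<in> \<T>" "x \<in> T"
  shows "barycentric (verts T) (\<lambda>z. hat \<T> z x) x"
proof -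
  obtain u where u: "barycentric (verts T) u x"
    using barycentric_exists[OF finite_verts[OF assms(1)]] simplex_verts(3)[OF full_simplex[OF assms(1)]]
      assms(2) by blast
  then show ?thesis using hat_eq[OF assms(1) u] by simp
qed

lemma hat_affine_on_cell:
  assumes "T \<in> \<T>"
  obtains a b where "\<And>x. x \<in> T \<Longrightarrow> hat \<T> z x = a \<bullet> x + b"
proof (cases "z \<in> verts T")
  case True
  obtain a b where ab: "\<And>u. sum u (verts T) = 1 \<Longrightarrow> a \<bullet> (\<Sum>w\<in>verts T. u w *\<^sub>R w) + b = u z"
    using barycentric_coordinate_affine[OF simplex_verts(2)[OF full_simplex[OF assms]] True] by blast
  have "hat \<T> z x = a \<bullet> x + b" if "x \<in> T" for x
    using ab[of "\<lambda>z. hat \<T> z x"] barycentric_hat[OF assms that] by (simp add: barycentric_def)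
  then show ?thesis using that by blast
next
  case False
  then have "hat \<T> z x = 0 \<bullet> x + 0" if "x \<in> T" for x
    using barycentric_hat[OF assms that] by (simp add: barycentric_def)
  then show ?thesis using that by blast
qed

lemma continuous_on_mesh:
  fixes v :: "real^'n \<Rightarrow> 'b::topological_space"
  assumes "\<And>T. T \<in> \<T> \<Longrightarrow> continuous_on T v"
  shows "continuous_on (\<Union>\<T>) v"
  using continuous_on_closed_Union[of \<T> "\<lambda>T. T" v] finite_mesh assms compact_cell compact_imp_closed
  by auto

section \<open>The Lagrange basis\<close>

definition lattice :: "(real^'n) set \<Rightarrow> nat \<Rightarrow> (real^'n \<Rightarrow> nat) set" where
  "lattice T m = {\<alpha>. (\<forall>z. z \<notin> verts T \<longrightarrow> \<alpha> z = 0) \<and> sum \<alpha> (verts T) = m}"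

text \<open>With \<open>t z\<close> denoting \<open>p\<close> times the hat function of \<open>z\<close>, the basis function of a lattice
  point is the product of the binomials \<open>t z\<close> over \<open>\<alpha> z\<close>. At the lattice point \<open>\<beta>\<close> it becomes the product of
  \<open>\<beta> z\<close> over \<open>\<alpha> z\<close>, which vanishes as soon as some \<open>\<beta> z\<close> is smaller than \<open>\<alpha> z\<close>.\<close>

definition nodal_basis :: "(real^'n \<Rightarrow> nat) \<Rightarrow> real^'n \<Rightarrow> real" where
  "nodal_basis \<alpha> x = (\<Prod>z | \<alpha> z \<noteq> 0. (real p * hat \<T> z x) gchoose \<alpha> z)"

lemma nodal_basis_superset:
  assumes "finite Z" "\<And>z. z \<notin> Z \<Longrightarrow> \<alpha> z = 0"
  shows "nodal_basis \<alpha> x = (\<Prod>z\<in>Z. (real p * hat \<T> z x) gchoose \<alpha> z)"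
  unfolding nodal_basis_def
proof (rule prod.mono_neutral_left[OF assms(1)])
  show "{z. \<alpha> z \<noteq> 0} \<subseteq> Z"
  proof
    fix z assume "z \<in> {z. \<alpha> z \<noteq> 0}"
    then show "z \<in> Z" using assms(2)[of z] by auto
  qed
qed simp

lemma finite_lattice:
  assumes "T \<in> \<T>"
  shows "finite (lattice T m)"
proof (rule finite_subset)
  show "lattice T m \<subseteq> {\<alpha>. \<forall>z. (z \<in> verts T \<longrightarrow> \<alpha> z \<in> {..m}) \<and> (z \<notin> verts T \<longrightarrow> \<alpha> z = 0)}"
  proof (clarsimp simp: lattice_def)
    fix \<alpha> :: "real^'n \<Rightarrow> nat" and z assume "z \<in> verts T"
    then show "\<alpha> z \<le> sum \<alpha> (verts T)"
      using finite_verts[OF assms] by (intro member_le_sum) auto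
  qed
  show "finite {\<alpha>. \<forall>z. (z \<in> verts T \<longrightarrow> \<alpha> z \<in> {..m}) \<and> (z \<notin> verts T \<longrightarrow> \<alpha> z = 0)}"
    using finite_verts[OF assms] by (intro finite_set_of_finite_funs) auto
qed

lemma lagrange_node_of_lattice:
  assumes T: "T \<in> \<T>" and \<alpha>: "\<alpha> \<in> lattice T p"
  obtains x where "x \<in> lagrange_nodes p T" "x \<in> T" "\<And>z. real p * hat \<T> z x = real (\<alpha> z)"
proof -
  define x where "x = (\<Sum>z\<in>verts T. (real (\<alpha> z) / real p) *\<^sub>R z)"
  have "(\<Sum>z\<in>verts T. real (\<alpha> z) / real p) = 1"
    using \<alpha> degree by (simp add: lattice_def flip: sum_divide_distrib of_nat_sum)
  then have b: "barycentric (verts T) (\<lambda>z. real (\<alpha> z) / real p) x"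
    using \<alpha> by (simp add: barycentric_def lattice_def x_def)
  have "x \<in> lagrange_nodes p T"
    using \<alpha> unfolding lagrange_nodes_def x_def lattice_def verts_def by blast
  moreover have "x \<in> convex hull verts T"
    using barycentric_in_hull[OF finite_verts[OF T] b] .
  then have "x \<in> T" using simplex_verts(3)[OF full_simplex[OF T]] by simp
  moreover have "real p * hat \<T> z x = real (\<alpha> z)" for z
    using hat_eq[OF T b] degree by simp
  ultimately show ?thesis using that by blast
qed

lemma lattice_of_lagrange_node:
  assumes T: "T \<in> \<T>" and x: "x \<in> lagrange_nodes p T"
  obtains \<alpha> where "\<alpha> \<in> lattice T p" "x \<in> T" "\<And>z. real p * hat \<T> z x = real (\<alpha> z)"
proof -
  obtain \<alpha>' where \<alpha>': "sum \<alpha>' (verts T) = p" "x = (\<Sum>z\<in>verts T. (real (\<alpha>' z) / real p) *\<^sub>R z)"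
    using x unfolding lagrange_nodes_def verts_def by blast
  define \<alpha> where "\<alpha> z = (if z \<in> verts T then \<alpha>' z else 0)" for z
  have \<alpha>: "\<alpha> \<in> lattice T p" using \<alpha>' by (simp add: lattice_def \<alpha>_def)
  have x': "x = (\<Sum>z\<in>verts T. (real (\<alpha> z) / real p) *\<^sub>R z)" using \<alpha>' by (simp add: \<alpha>_def)
  have "(\<Sum>z\<in>verts T. real (\<alpha> z) / real p) = 1"
    using \<alpha> degree by (simp add: lattice_def flip: sum_divide_distrib of_nat_sum)
  then have b: "barycentric (verts T) (\<lambda>z. real (\<alpha> z) / real p) x"
    using \<alpha> x' by (simp add: barycentric_def lattice_def)
  have "x \<in> convex hull verts T"
    using barycentric_in_hull[OF finite_verts[OF T] b] .
  then have "x \<in> T" using simplex_verts(3)[OF full_simplex[OF T]] by simp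
  then show ?thesis using that[OF \<alpha>] hat_eq[OF T b] degree by simp
qed

lemma finite_fe_nodes: "finite (fe_nodes \<T> p)"
proof -
  have "finite (lagrange_nodes p T)" if T: "T \<in> \<T>" for T
  proof (rule finite_subset)
    show "lagrange_nodes p T \<subseteq> (\<lambda>\<alpha>. \<Sum>z\<in>verts T. (real (\<alpha> z) / real p) *\<^sub>R z) ` lattice T p"
    proof
      fix x assume "x \<in> lagrange_nodes p T"
      then obtain \<alpha>' where \<alpha>': "sum \<alpha>' (verts T) = p"
          "x = (\<Sum>z\<in>verts T. (real (\<alpha>' z) / real p) *\<^sub>R z)"
        unfolding lagrange_nodes_def verts_def by blast
      then show "x \<in> (\<lambda>\<alpha>. \<Sum>z\<in>verts T. (real (\<alpha> z) / real p) *\<^sub>R z) ` lattice T p"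
        by (intro image_eqI[where x = "\<lambda>z. if z \<in> verts T then \<alpha>' z else 0"])
          (auto simp: lattice_def)
    qed
  qed (simp add: finite_lattice T)
  then show ?thesis using finite_mesh by (simp add: fe_nodes_def)
qed

text \<open>Both multi-indices sum to \<open>p\<close>; unless they are equal, some \<open>\<beta> z\<close> is therefore smaller than
  \<open>\<alpha> z\<close>, and the corresponding binomial vanishes. The two lattices may belong to different simplices,
  as the basis functions are to be global.\<close>

lemma nodal_basis_at_node:
  assumes "T \<in> \<T>" "\<alpha> \<in> lattice T p" "T' \<in> \<T>" "\<beta> \<in> lattice T' p"
    and x: "\<And>z. real p * hat \<T> z x = real (\<beta> z)"
  shows "nodal_basis \<alpha> x = (if \<alpha> = \<beta> then 1 else 0)"
proof -
  let ?Z = "verts T \<union> verts T'"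
  have fin: "finite ?Z" using finite_verts assms by blast
  have B: "nodal_basis \<alpha> x = real (\<Prod>z\<in>?Z. \<beta> z choose \<alpha> z)"
    using assms nodal_basis_superset[OF fin, of \<alpha>]
    by (simp add: x lattice_def flip: binomial_gbinomial)
  have off: "z \<notin> ?Z \<Longrightarrow> \<alpha> z = 0" "z \<notin> ?Z \<Longrightarrow> \<beta> z = 0" for z
    using assms by (auto simp: lattice_def)
  show ?thesis
  proof (cases "\<forall>z. \<alpha> z \<le> \<beta> z")
    case True
    have "sum \<alpha> ?Z = sum \<alpha> (verts T)"
      using assms by (intro sum.mono_neutral_right[OF fin]) (auto simp: lattice_def)
    moreover have "sum \<beta> ?Z = sum \<beta> (verts T')"
      using assms by (intro sum.mono_neutral_right[OF fin]) (auto simp: lattice_def)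
    ultimately have "sum \<alpha> ?Z = sum \<beta> ?Z" using assms by (simp add: lattice_def)
    then have "\<alpha> z = \<beta> z" if "z \<in> ?Z" for z
      using sum_mono_inv[of \<alpha> ?Z \<beta> z] True that fin by simp
    then have "\<alpha> = \<beta>" using off by fastforce
    then show ?thesis using B by simp
  next
    case False
    then obtain z where z: "\<beta> z < \<alpha> z" by (auto simp: not_le)
    then have "z \<in> ?Z" "\<beta> z choose \<alpha> z = 0" using off by (force, simp add: binomial_eq_0)
    then have "(\<Prod>z\<in>?Z. \<beta> z choose \<alpha> z) = 0" using fin by (meson prod_zero)
    then show ?thesis using B z by (auto simp del: prod_zero_iff)
  qed
qed

text \<open>On a single simplex every hat function is affine, also those of vertices outside the simplex, where it is
  zero; the degree is the sum of the binomial indices.\<close>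

lemma nodal_basis_poly_on_cell:
  assumes T: "T \<in> \<T>" and S: "S \<in> \<T>" "\<alpha> \<in> lattice S p"
  obtains q where "q \<in> polys p" "\<And>x. x \<in> T \<Longrightarrow> of_real (nodal_basis \<alpha> x) = q x"
proof -
  have "\<exists>a b. \<forall>x\<in>T. hat \<T> z x = a \<bullet> x + b" for z
    using hat_affine_on_cell[OF T] by metis
  then obtain a b where ab: "\<And>z x. x \<in> T \<Longrightarrow> hat \<T> z x = a z \<bullet> x + b z" by metis
  have "(\<lambda>x. of_real (\<Prod>z\<in>verts S. ((real p *\<^sub>R a z) \<bullet> x + real p * b z) gchoose \<alpha> z)) \<in> polys p"
    using polys_prod_affine_gbinomial[OF finite_verts[OF S(1)], of "\<lambda>z. real p *\<^sub>R a z" "\<lambda>z. real p * b z" \<alpha>] S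
    by (simp add: lattice_def)
  moreover have "nodal_basis \<alpha> x = (\<Prod>z\<in>verts S. ((real p *\<^sub>R a z) \<bullet> x + real p * b z) gchoose \<alpha> z)"
    if "x \<in> T" for x
    using nodal_basis_superset[OF finite_verts[OF S(1)], of \<alpha>] S(2) ab[OF that]
    by (simp add: lattice_def distrib_left)
  ultimately show ?thesis
    by (intro that[of "\<lambda>x. of_real (\<Prod>z\<in>verts S. ((real p *\<^sub>R a z) \<bullet> x + real p * b z) gchoose \<alpha> z)"])
      simp_all
qed

text \<open>The interpolant is the combination of the global basis functions. Continuity across common faces comes for
  free, because it is inherited from the hat functions.\<close>

lemma fe_space_interpolation_exists:
  assumes closure: "closure \<Omega> = \<Union>\<T>"
  obtains w where "w \<in> fe_space \<Omega> \<T> p" "\<And>x. x \<in> fe_nodes \<T> p \<Longrightarrow> w x = g x"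
proof -
  have "\<exists>\<alpha> T. y \<in> fe_nodes \<T> p \<longrightarrow> (T \<in> \<T> \<and> \<alpha> \<in> lattice T p \<and> y \<in> T \<and>
      (\<forall>z. real p * hat \<T> z y = real (\<alpha> z)))" for y
  proof (cases "y \<in> fe_nodes \<T> p")
    case True
    then obtain T where T: "T \<in> \<T>" "y \<in> lagrange_nodes p T" by (auto simp: fe_nodes_def)
    from lattice_of_lagrange_node[OF this] show ?thesis using T(1) by metis
  qed simp
  then obtain ix cell where ix: "\<And>y. y \<in> fe_nodes \<T> p \<Longrightarrow> cell y \<in> \<T> \<and> ix y \<in> lattice (cell y) p \<and>
      y \<in> cell y \<and> (\<forall>z. real p * hat \<T> z y = real (ix y z))"
    by metis
  define h where "h x = (\<Sum>y\<in>fe_nodes \<T> p. g y * of_real (nodal_basis (ix y) x))" for x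
  define w where "w x = (if x \<in> closure \<Omega> then h x else 0)" for x
  have poly: "\<exists>q\<in>polys p. \<forall>x\<in>T. h x = q x" if T: "T \<in> \<T>" for T
  proof -
    have "\<exists>q. y \<in> fe_nodes \<T> p \<longrightarrow> q \<in> polys p \<and> (\<forall>x\<in>T. of_real (nodal_basis (ix y) x) = q x)" for y
      using ix[of y] nodal_basis_poly_on_cell[OF T] by metis
    then obtain q where q: "\<And>y. y \<in> fe_nodes \<T> p \<Longrightarrow>
        q y \<in> polys p \<and> (\<forall>x\<in>T. of_real (nodal_basis (ix y) x) = q y x)" by metis
    have "(\<lambda>x. \<Sum>y\<in>fe_nodes \<T> p. g y * q y x) \<in> polys p"
      using q by (intro polys_sum polys_scale) auto
    moreover have "h x = (\<Sum>y\<in>fe_nodes \<T> p. g y * q y x)" if "x \<in> T" for x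
      using q that by (auto simp: h_def intro!: sum.cong)
    ultimately show ?thesis by (intro bexI[of _ "\<lambda>x. \<Sum>y\<in>fe_nodes \<T> p. g y * q y x"]) auto
  qed
  have cont: "continuous_on (\<Union>\<T>) h"
  proof (rule continuous_on_mesh)
    fix T assume "T \<in> \<T>"
    then obtain q where q: "q \<in> polys p" "\<forall>x\<in>T. h x = q x" using poly by blast
    then have "continuous_on T q" by (simp add: polys_continuous_on)
    then show "continuous_on T h" using q(2) by (simp cong: continuous_on_cong)
  qed
  have "w \<in> fe_space \<Omega> \<T> p"
    unfolding fe_space_def
  proof (intro CollectI conjI ballI allI impI)
    have "continuous_on (closure \<Omega>) h" using cont closure by simp
    then show "continuous_on (closure \<Omega>) w"
      by (rule continuous_on_eq) (simp add: w_def)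
    fix T assume T: "T \<in> \<T>"
    then show "\<exists>q\<in>polys p. \<forall>x\<in>T. w x = q x" using poly[OF T] closure by (auto simp: w_def)
  qed (simp add: w_def)
  moreover have "w x = g x" if x: "x \<in> fe_nodes \<T> p" for x
  proof -
    have xT: "x \<in> \<Union>\<T>" using ix[OF x] by blast
    \<comment> \<open>a node is recovered from its index, as its coordinates are the index divided by \<open>p\<close>\<close>
    have inj: "ix y = ix x \<longleftrightarrow> y = x" if y: "y \<in> fe_nodes \<T> p" for y
    proof
      assume eq: "ix y = ix x"
      then have hat: "hat \<T> z y = hat \<T> z x" for z
      proof -
        have "real p * hat \<T> z y = real p * hat \<T> z x" using ix[OF x] ix[OF y] eq by simp
        then show ?thesis using degree by simp
      qed
      have "barycentric (verts (cell y)) (\<lambda>z. hat \<T> z y) y"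
        "barycentric (verts (cell x)) (\<lambda>z. hat \<T> z x) x"
        using ix[OF x] ix[OF y] barycentric_hat by blast+
      then have "barycentric (verts (cell x) \<union> verts (cell y)) (\<lambda>z. hat \<T> z x) y"
        "barycentric (verts (cell x) \<union> verts (cell y)) (\<lambda>z. hat \<T> z x) x"
        using hat ix[OF x] ix[OF y] finite_verts by (auto intro: barycentric_mono)
      then show "y = x" by (simp add: barycentric_def)
    qed simp
    have "h x = (\<Sum>y\<in>fe_nodes \<T> p. g y * (if y = x then 1 else 0))"
      unfolding h_def
    proof (rule sum.cong)
      fix y assume y: "y \<in> fe_nodes \<T> p"
      show "g y * of_real (nodal_basis (ix y) x) = g y * (if y = x then 1 else 0)"
        using nodal_basis_at_node[of "cell y" "ix y" "cell x" "ix x" x] ix[OF x] ix[OF y] inj[OF y] by auto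
    qed simp
    also have "\<dots> = g x" using x finite_fe_nodes by (simp add: if_distrib cong: if_cong)
    finally show ?thesis using xT closure by (simp add: w_def)
  qed
  ultimately show ?thesis using that by blast
qed

end

context simplicial_mesh
begin

lemma lattice_increment:
  assumes "T \<in> \<T>" "\<alpha> \<in> lattice T m" "z \<in> verts T"
  shows "\<alpha>(z := Suc (\<alpha> z)) \<in> lattice T (Suc m)"
proof -
  have "sum (\<alpha>(z := Suc (\<alpha> z))) (verts T - {z}) = sum \<alpha> (verts T - {z})"
    by (rule sum.cong) auto
  then show ?thesis using assms finite_verts[OF assms(1)]
    by (auto simp: lattice_def sum.remove[of _ z])
qed

text \<open>With \<open>t = p \<lambda>\<^sub>z\<close> and \<open>k = \<alpha> z\<close> this is the recursion
  \<open>t (t gchoose k) = k (t gchoose k) + (k + 1) (t gchoose (k + 1))\<close> for a single factor of the basis function.\<close>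

lemma nodal_basis_hat_mult:
  assumes "T \<in> \<T>" "\<alpha> \<in> lattice T m" "z \<in> verts T"
  shows "real p * hat \<T> z x * nodal_basis \<alpha> x =
    real (\<alpha> z) * nodal_basis \<alpha> x + real (Suc (\<alpha> z)) * nodal_basis (\<alpha>(z := Suc (\<alpha> z))) x"
proof -
  note fin = finite_verts[OF assms(1)]
  define R where "R = (\<Prod>w\<in>verts T - {z}. (real p * hat \<T> w x) gchoose \<alpha> w)"
  have "nodal_basis \<alpha> x = ((real p * hat \<T> z x) gchoose \<alpha> z) * R"
    using assms nodal_basis_superset[OF fin, of \<alpha>]
    by (simp add: lattice_def R_def prod.remove[OF fin assms(3)])
  moreover have "(\<Prod>w\<in>verts T - {z}. (real p * hat \<T> w x) gchoose (\<alpha>(z := Suc (\<alpha> z))) w) = R"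
    unfolding R_def by (rule prod.cong) auto
  then have "nodal_basis (\<alpha>(z := Suc (\<alpha> z))) x = ((real p * hat \<T> z x) gchoose Suc (\<alpha> z)) * R"
    using lattice_increment[OF assms] nodal_basis_superset[OF fin, of "\<alpha>(z := Suc (\<alpha> z))"]
    by (simp add: lattice_def prod.remove[OF fin assms(3)])
  ultimately show ?thesis
    using gbinomial_mult_1[of "real p * hat \<T> z x" "\<alpha> z"] by algebra
qed

text \<open>The hat functions sum to one, so adding up the recursion over the vertices expresses a basis
  function of level \<open>m < p\<close> through those of level \<open>m + 1\<close>.\<close>

lemma nodal_basis_raise:
  assumes T: "T \<in> \<T>" and \<alpha>: "\<alpha> \<in> lattice T m" and x: "x \<in> T"
  shows "(real p - real m) * nodal_basis \<alpha> x =
    (\<Sum>z\<in>verts T. real (Suc (\<alpha> z)) * nodal_basis (\<alpha>(z := Suc (\<alpha> z))) x)"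
proof -
  have "(\<Sum>z\<in>verts T. hat \<T> z x) = 1"
    using barycentric_hat[OF T x] by (simp add: barycentric_def)
  moreover have "(\<Sum>z\<in>verts T. real (\<alpha> z)) = real m"
    using \<alpha> by (simp add: lattice_def flip: of_nat_sum)
  ultimately have "(real p - real m) * nodal_basis \<alpha> x =
      (\<Sum>z\<in>verts T. real p * hat \<T> z x * nodal_basis \<alpha> x - real (\<alpha> z) * nodal_basis \<alpha> x)"
    by (simp add: sum_subtractf left_diff_distrib flip: sum_distrib_left sum_distrib_right)
  also have "\<dots> = (\<Sum>z\<in>verts T. real (Suc (\<alpha> z)) * nodal_basis (\<alpha>(z := Suc (\<alpha> z))) x)"
    by (rule sum.cong[OF refl]) (simp only: nodal_basis_hat_mult[OF T \<alpha>] add_diff_cancel_left')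
  finally show ?thesis .
qed

definition basis_span :: "(real^'n) set \<Rightarrow> nat \<Rightarrow> (real^'n \<Rightarrow> complex) set" where
  "basis_span T m = {h. \<exists>c. \<forall>x\<in>T. h x = (\<Sum>\<alpha>\<in>lattice T m. c \<alpha> * of_real (nodal_basis \<alpha> x))}"

lemma basis_span_cong:
  assumes "h \<in> basis_span T m" "\<And>x. x \<in> T \<Longrightarrow> h' x = h x"
  shows "h' \<in> basis_span T m"
  using assms unfolding basis_span_def by auto

lemma basis_span_add:
  assumes "h \<in> basis_span T m" "h' \<in> basis_span T m"
  shows "(\<lambda>x. h x + h' x) \<in> basis_span T m"
proof -
  obtain c c' where "\<forall>x\<in>T. h x = (\<Sum>\<alpha>\<in>lattice T m. c \<alpha> * of_real (nodal_basis \<alpha> x))"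
    "\<forall>x\<in>T. h' x = (\<Sum>\<alpha>\<in>lattice T m. c' \<alpha> * of_real (nodal_basis \<alpha> x))"
    using assms unfolding basis_span_def by blast
  then have "\<forall>x\<in>T. h x + h' x = (\<Sum>\<alpha>\<in>lattice T m. (c \<alpha> + c' \<alpha>) * of_real (nodal_basis \<alpha> x))"
    by (simp add: distrib_right sum.distrib)
  then show ?thesis unfolding basis_span_def by (intro CollectI exI[where x = "\<lambda>\<alpha>. c \<alpha> + c' \<alpha>"])
qed

lemma basis_span_scale:
  assumes "h \<in> basis_span T m"
  shows "(\<lambda>x. b * h x) \<in> basis_span T m"
proof -
  obtain c where "\<forall>x\<in>T. h x = (\<Sum>\<alpha>\<in>lattice T m. c \<alpha> * of_real (nodal_basis \<alpha> x))"
    using assms unfolding basis_span_def by blast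
  then have "\<forall>x\<in>T. b * h x = (\<Sum>\<alpha>\<in>lattice T m. (b * c \<alpha>) * of_real (nodal_basis \<alpha> x))"
    by (simp add: sum_distrib_left mult.assoc)
  then show ?thesis unfolding basis_span_def by (intro CollectI exI[where x = "\<lambda>\<alpha>. b * c \<alpha>"])
qed

lemma basis_span_sum:
  assumes "\<And>i. i \<in> I \<Longrightarrow> h i \<in> basis_span T m"
  shows "(\<lambda>x. \<Sum>i\<in>I. h i x) \<in> basis_span T m"
proof -
  have zero: "(\<lambda>x. 0) \<in> basis_span T m"
    unfolding basis_span_def by (intro CollectI exI[where x = "\<lambda>_. 0"]) simp
  show ?thesis using assms
    by (induction I rule: infinite_finite_induct) (simp_all add: zero basis_span_add)
qed

lemma basis_span_basis:
  assumes "T \<in> \<T>" "\<alpha> \<in> lattice T m"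
  shows "(\<lambda>x. of_real (nodal_basis \<alpha> x)) \<in> basis_span T m"
proof -
  have "of_real (nodal_basis \<alpha> x) =
      (\<Sum>\<beta>\<in>lattice T m. (if \<beta> = \<alpha> then 1 else 0) * of_real (nodal_basis \<beta> x) :: complex)" for x
    using assms finite_lattice[OF assms(1)]
    by (simp add: if_distrib[of "\<lambda>c. c * _"] sum.delta cong: if_cong)
  then show ?thesis
    unfolding basis_span_def by (intro CollectI exI[where x = "\<lambda>\<beta>. if \<beta> = \<alpha> then 1 else 0"]) simp
qed

lemma basis_span_raise:
  assumes K: "\<And>\<alpha>. \<alpha> \<in> lattice T m \<Longrightarrow> (\<lambda>x. g x * of_real (nodal_basis \<alpha> x)) \<in> basis_span T m'"
    and h: "h \<in> basis_span T m"
  shows "(\<lambda>x. g x * h x) \<in> basis_span T m'"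
proof -
  obtain c where c: "\<forall>x\<in>T. h x = (\<Sum>\<alpha>\<in>lattice T m. c \<alpha> * of_real (nodal_basis \<alpha> x))"
    using h unfolding basis_span_def by blast
  have "(\<lambda>x. \<Sum>\<alpha>\<in>lattice T m. c \<alpha> * (g x * of_real (nodal_basis \<alpha> x))) \<in> basis_span T m'"
    by (intro basis_span_sum basis_span_scale K)
  then show ?thesis
    by (rule basis_span_cong) (simp add: c sum_distrib_left mult.left_commute)
qed

lemma basis_span_Suc:
  assumes T: "T \<in> \<T>" and m: "m < p"
  shows "basis_span T m \<subseteq> basis_span T (Suc m)"
proof
  fix h assume h: "h \<in> basis_span T m"
  have "(\<lambda>x. 1 * h x) \<in> basis_span T (Suc m)"
  proof (rule basis_span_raise[OF _ h])
    fix \<alpha> assume \<alpha>: "\<alpha> \<in> lattice T m"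
    have "(\<lambda>x. \<Sum>z\<in>verts T. of_real (real (Suc (\<alpha> z)) / (real p - real m)) *
        of_real (nodal_basis (\<alpha>(z := Suc (\<alpha> z))) x)) \<in> basis_span T (Suc m)"
      by (intro basis_span_sum basis_span_scale basis_span_basis[OF T] lattice_increment[OF T \<alpha>])
    then show "(\<lambda>x. 1 * of_real (nodal_basis \<alpha> x)) \<in> basis_span T (Suc m)"
    proof (rule basis_span_cong)
      fix x assume x: "x \<in> T"
      have "nodal_basis \<alpha> x =
          (\<Sum>z\<in>verts T. real (Suc (\<alpha> z)) * nodal_basis (\<alpha>(z := Suc (\<alpha> z))) x) / (real p - real m)"
        using nodal_basis_raise[OF T \<alpha> x] m by (simp add: field_simps)
      also have "\<dots> = (\<Sum>z\<in>verts T. real (Suc (\<alpha> z)) / (real p - real m) *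
          nodal_basis (\<alpha>(z := Suc (\<alpha> z))) x)"
        by (simp add: sum_divide_distrib)
      finally show "1 * of_real (nodal_basis \<alpha> x) =
          (\<Sum>z\<in>verts T. of_real (real (Suc (\<alpha> z)) / (real p - real m)) *
            of_real (nodal_basis (\<alpha>(z := Suc (\<alpha> z))) x) :: complex)"
        by (simp only: mult_1 of_real_sum of_real_mult)
    qed
  qed
  then show "h \<in> basis_span T (Suc m)" by simp
qed

lemma basis_span_hat_mult:
  assumes T: "T \<in> \<T>" and m: "m < p" and h: "h \<in> basis_span T m" and z: "z \<in> verts T"
  shows "(\<lambda>x. of_real (hat \<T> z x) * h x) \<in> basis_span T (Suc m)"
proof (rule basis_span_raise[OF _ h])
  fix \<alpha> assume \<alpha>: "\<alpha> \<in> lattice T m"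
  have "(\<lambda>x. of_real (real (\<alpha> z) / real p) * of_real (nodal_basis \<alpha> x) +
      of_real (real (Suc (\<alpha> z)) / real p) * of_real (nodal_basis (\<alpha>(z := Suc (\<alpha> z))) x))
      \<in> basis_span T (Suc m)"
    by (intro basis_span_add basis_span_scale subsetD[OF basis_span_Suc[OF T m] basis_span_basis[OF T \<alpha>]]
        basis_span_basis[OF T lattice_increment[OF T \<alpha> z]])
  then show "(\<lambda>x. of_real (hat \<T> z x) * of_real (nodal_basis \<alpha> x)) \<in> basis_span T (Suc m)"
  proof (rule basis_span_cong)
    fix x
    have "hat \<T> z x * nodal_basis \<alpha> x = real (\<alpha> z) / real p * nodal_basis \<alpha> x +
        real (Suc (\<alpha> z)) / real p * nodal_basis (\<alpha>(z := Suc (\<alpha> z))) x"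
      using nodal_basis_hat_mult[OF T \<alpha> z, of x] degree by (simp add: field_simps)
    then show "of_real (hat \<T> z x) * of_real (nodal_basis \<alpha> x) =
        of_real (real (\<alpha> z) / real p) * of_real (nodal_basis \<alpha> x) +
        (of_real (real (Suc (\<alpha> z)) / real p) * of_real (nodal_basis (\<alpha>(z := Suc (\<alpha> z))) x) :: complex)"
      by (simp only: flip: of_real_mult of_real_add)
  qed
qed

text \<open>Together with the two raising lemmas, the expansion of a coordinate in hat functions shows that the
  spans form a filtration of the kind required by \<open>polys_subset_filtration\<close>.\<close>

lemma polys_in_basis_span:
  assumes T: "T \<in> \<T>"
  shows "polys p \<subseteq> basis_span T p"
proof (rule polys_subset_filtration[where K = "basis_span T"])
  fix c :: complex
  have "(\<lambda>_. 0) \<in> lattice T 0" by (simp add: lattice_def)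
  from basis_span_scale[OF basis_span_basis[OF T this], of c]
  show "(\<lambda>x. c) \<in> basis_span T 0" by (simp add: nodal_basis_def)
next
  fix m i h assume m: "m < p" and h: "h \<in> basis_span T m"
  have "(\<lambda>x. \<Sum>z\<in>verts T. of_real (z $ i) * (of_real (hat \<T> z x) * h x)) \<in> basis_span T (Suc m)"
    by (intro basis_span_sum basis_span_scale basis_span_hat_mult T m h)
  then show "(\<lambda>x. of_real (x $ i) * h x) \<in> basis_span T (Suc m)"
  proof (rule basis_span_cong)
    fix x assume "x \<in> T"
    then have "(\<Sum>z\<in>verts T. hat \<T> z x *\<^sub>R z) = x"
      using barycentric_hat[OF T] by (simp add: barycentric_def)
    from arg_cong[OF this, of "\<lambda>v. v $ i"]
    have "complex_of_real (x $ i) = (\<Sum>z\<in>verts T. of_real (hat \<T> z x) * of_real (z $ i))"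
      by (simp flip: of_real_mult of_real_sum)
    then show "of_real (x $ i) * h x = (\<Sum>z\<in>verts T. of_real (z $ i) * (of_real (hat \<T> z x) * h x))"
      by (simp add: sum_distrib_left mult_ac)
  qed
qed (use basis_span_add basis_span_scale basis_span_Suc[OF T] in auto)

text \<open>A polynomial is a combination of the basis functions of level \<open>p\<close>, and evaluation at the nodes reads off the
  coefficients.\<close>

lemma polys_unisolvent:
  assumes T: "T \<in> \<T>" and q: "q \<in> polys p"
    and zero: "\<And>x. x \<in> lagrange_nodes p T \<Longrightarrow> q x = 0" and x: "x \<in> T"
  shows "q x = 0"
proof -
  obtain c where c: "\<forall>x\<in>T. q x = (\<Sum>\<alpha>\<in>lattice T p. c \<alpha> * of_real (nodal_basis \<alpha> x))"
    using polys_in_basis_span[OF T] q unfolding basis_span_def by blast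
  have "c \<beta> = 0" if \<beta>: "\<beta> \<in> lattice T p" for \<beta>
  proof -
    obtain y where y: "y \<in> lagrange_nodes p T" "y \<in> T" "\<And>z. real p * hat \<T> z y = real (\<beta> z)"
      using lagrange_node_of_lattice[OF T \<beta>] by blast
    have "0 = (\<Sum>\<alpha>\<in>lattice T p. c \<alpha> * of_real (nodal_basis \<alpha> y))" using zero[OF y(1)] c y(2) by simp
    also have "\<dots> = (\<Sum>\<alpha>\<in>lattice T p. if \<alpha> = \<beta> then c \<alpha> else 0)"
      using nodal_basis_at_node[OF T _ T \<beta> y(3)] by (intro sum.cong) auto
    also have "\<dots> = c \<beta>" using \<beta> finite_lattice[OF T] by simp
    finally show ?thesis by simp
  qed
  then show ?thesis using c x by simp
qed

section \<open>Nodal interpolation, zero extension and weighted extension\<close>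

lemma fe_space_scale: "v \<in> fe_space \<Omega> \<T> p \<Longrightarrow> (\<lambda>x. c * v x) \<in> fe_space \<Omega> \<T> p"
proof (clarsimp simp: fe_space_def, intro conjI ballI)
  fix T assume "\<forall>T\<in>\<T>. \<exists>q\<in>polys p. \<forall>x\<in>T. v x = q x" "T \<in> \<T>"
  then obtain q where "q \<in> polys p" "\<forall>x\<in>T. v x = q x" by blast
  then show "\<exists>q\<in>polys p. \<forall>x\<in>T. c * v x = q x"
    by (intro bexI[of _ "\<lambda>x. c * q x"] polys_scale) auto
qed (auto intro: continuous_intros)

lemma fe_space_add:
  "v \<in> fe_space \<Omega> \<T> p \<Longrightarrow> w \<in> fe_space \<Omega> \<T> p \<Longrightarrow> (\<lambda>x. v x + w x) \<in> fe_space \<Omega> \<T> p"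
proof (clarsimp simp: fe_space_def, intro conjI ballI)
  fix T assume "\<forall>T\<in>\<T>. \<exists>q\<in>polys p. \<forall>x\<in>T. v x = q x" "\<forall>T\<in>\<T>. \<exists>q\<in>polys p. \<forall>x\<in>T. w x = q x" "T \<in> \<T>"
  then obtain q r where "q \<in> polys p" "\<forall>x\<in>T. v x = q x" "r \<in> polys p" "\<forall>x\<in>T. w x = r x" by metis
  then show "\<exists>q\<in>polys p. \<forall>x\<in>T. v x + w x = q x"
    by (intro bexI[of _ "\<lambda>x. q x + r x"] polys_add) auto
qed (auto intro: continuous_intros)

lemma fe_space_sum:
  "(\<And>i. i \<in> I \<Longrightarrow> v i \<in> fe_space \<Omega> \<T> p) \<Longrightarrow> (\<lambda>x. \<Sum>i\<in>I. v i x) \<in> fe_space \<Omega> \<T> p"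
proof (induction I rule: infinite_finite_induct)
  case (insert i I)
  then show ?case using fe_space_add[of "v i"] by simp
qed (auto simp: fe_space_def intro!: bexI[of _ "\<lambda>_. 0"] polys_const)

lemma local_space_add:
  assumes "v \<in> local_space \<Omega> \<T> p D" "w \<in> local_space \<Omega> \<T> p D"
  shows "(\<lambda>x. v x + w x) \<in> local_space \<Omega> \<T> p D"
proof -
  obtain v' w' where "v' \<in> fe_space \<Omega> \<T> p" "w' \<in> fe_space \<Omega> \<T> p"
    "v = restr (closure D) v'" "w = restr (closure D) w'"
    using assms unfolding local_space_def by blast
  then have "(\<lambda>x. v x + w x) = restr (closure D) (\<lambda>x. v' x + w' x)"
    "(\<lambda>x. v' x + w' x) \<in> fe_space \<Omega> \<T> p"
    by (auto simp: restr_def fe_space_add)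
  then show ?thesis unfolding local_space_def by blast
qed

lemma fe_space_unisolvent:
  assumes v: "v \<in> fe_space \<Omega> \<T> p" and w: "w \<in> fe_space \<Omega> \<T> p" and T: "T \<in> \<T>"
    and eq: "\<And>x. x \<in> fe_nodes \<T> p \<Longrightarrow> x \<in> T \<Longrightarrow> v x = w x" and x: "x \<in> T"
  shows "v x = w x"
proof -
  have "(\<lambda>x. v x + (- 1) * w x) \<in> fe_space \<Omega> \<T> p" using v w fe_space_add fe_space_scale by blast
  then obtain q where q: "q \<in> polys p" "\<forall>x\<in>T. v x + (- 1) * w x = q x"
    using T unfolding fe_space_def by blast
  have "q y = 0" if y: "y \<in> lagrange_nodes p T" for y
  proof -
    have "y \<in> T" using lattice_of_lagrange_node[OF T y] by blast
    moreover have "y \<in> fe_nodes \<T> p" using T y by (auto simp: fe_nodes_def)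
    ultimately show ?thesis using q(2)[THEN bspec, of y] eq[of y] by simp
  qed
  then have "q x = 0" using polys_unisolvent[OF T q(1) _ x] by blast
  then show ?thesis using q(2) x by force
qed

lemma fe_space_eqI:
  assumes closure: "closure \<Omega> = \<Union>\<T>" and v: "v \<in> fe_space \<Omega> \<T> p" and w: "w \<in> fe_space \<Omega> \<T> p"
    and eq: "\<And>x. x \<in> fe_nodes \<T> p \<Longrightarrow> v x = w x"
  shows "v = w"
proof
  fix x
  show "v x = w x"
  proof (cases "x \<in> closure \<Omega>")
    case True
    then obtain T where "T \<in> \<T>" "x \<in> T" using closure by blast
    then show ?thesis using fe_space_unisolvent[OF v w] eq by blast
  qed (use v w in \<open>auto simp: fe_space_def\<close>)
qed

text \<open>Since interpolation at the nodes is uniquely solvable, the zero extension depends only on nodal values; its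
  linearity follows by comparison of nodal values.\<close>

lemma zero_ext:
  assumes closure: "closure \<Omega> = \<Union>\<T>"
  shows zero_ext_in: "zero_ext \<Omega> \<T> p D v \<in> fe_space \<Omega> \<T> p"
    and zero_ext_node: "x \<in> fe_nodes \<T> p \<Longrightarrow>
      zero_ext \<Omega> \<T> p D v x = (if x \<in> closure D then v x else 0)"
proof -
  obtain w where "w \<in> fe_space \<Omega> \<T> p"
    "\<And>x. x \<in> fe_nodes \<T> p \<Longrightarrow> w x = (if x \<in> closure D then v x else 0)"
    using fe_space_interpolation_exists[OF closure, of "\<lambda>x. if x \<in> closure D then v x else 0"] by blast
  then have "\<exists>!w. w \<in> fe_space \<Omega> \<T> p \<and>
      (\<forall>x\<in>fe_nodes \<T> p. w x = (if x \<in> closure D then v x else 0))"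
    using fe_space_eqI[OF closure] by (intro ex1I[of _ w]) auto
  from theI'[OF this, folded zero_ext_def] show "zero_ext \<Omega> \<T> p D v \<in> fe_space \<Omega> \<T> p"
    "x \<in> fe_nodes \<T> p \<Longrightarrow> zero_ext \<Omega> \<T> p D v x = (if x \<in> closure D then v x else 0)"
    by auto
qed

lemma zero_ext_add:
  assumes closure: "closure \<Omega> = \<Union>\<T>"
  shows "zero_ext \<Omega> \<T> p D (\<lambda>x. v x + w x) = (\<lambda>x. zero_ext \<Omega> \<T> p D v x + zero_ext \<Omega> \<T> p D w x)"
  by (rule fe_space_eqI[OF closure]) (simp_all add: zero_ext_in fe_space_add zero_ext_node closure)

lemma zero_ext_scale:
  assumes closure: "closure \<Omega> = \<Union>\<T>"
  shows "zero_ext \<Omega> \<T> p D (\<lambda>x. c * v x) = (\<lambda>x. c * zero_ext \<Omega> \<T> p D v x)"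
  by (rule fe_space_eqI[OF closure]) (simp_all add: zero_ext_in fe_space_scale zero_ext_node closure)

text \<open>Interpolation on a subdomain is well defined because the closure of a mesh-resolved subdomain is
  a union of mesh simplices, each of which is unisolvent by itself.\<close>

lemma nodal_interp_node:
  assumes closure: "closure \<Omega> = \<Union>\<T>" and cells: "closure D \<subseteq> \<Union>{T\<in>\<T>. T \<subseteq> closure D}"
    and x: "x \<in> fe_nodes \<T> p" "x \<in> closure D"
  shows "nodal_interp \<Omega> \<T> p D v x = v x"
proof -
  obtain w where w: "w \<in> fe_space \<Omega> \<T> p" "\<And>x. x \<in> fe_nodes \<T> p \<Longrightarrow> w x = v x"
    using fe_space_interpolation_exists[OF closure, of v] by blast
  have "\<exists>!w. w \<in> local_space \<Omega> \<T> p D \<and> (\<forall>x\<in>fe_nodes \<T> p \<inter> closure D. w x = v x)"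
  proof (rule ex1I[of _ "restr (closure D) w"], intro conjI)
    show "restr (closure D) w \<in> local_space \<Omega> \<T> p D" using w by (simp add: local_space_def)
    show "\<forall>x\<in>fe_nodes \<T> p \<inter> closure D. restr (closure D) w x = v x" using w by (simp add: restr_def)
    fix u assume u: "u \<in> local_space \<Omega> \<T> p D \<and> (\<forall>x\<in>fe_nodes \<T> p \<inter> closure D. u x = v x)"
    then obtain u' where u': "u' \<in> fe_space \<Omega> \<T> p" "u = restr (closure D) u'"
      unfolding local_space_def by blast
    have "u' y = w y" if y: "y \<in> closure D" for y
    proof -
      obtain T where T: "T \<in> \<T>" "T \<subseteq> closure D" "y \<in> T" using cells y by blast
      have "u' z = w z" if z: "z \<in> fe_nodes \<T> p" "z \<in> T" for z
      proof -
        have "z \<in> fe_nodes \<T> p \<inter> closure D" using T z by blast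
        then have "u z = v z" "u z = u' z" using u u'(2) by (auto simp: restr_def)
        then show ?thesis using w(2) z by simp
      qed
      then show ?thesis using fe_space_unisolvent[OF u'(1) w(1) T(1) _ T(3)] by blast
    qed
    then show "u = restr (closure D) w" using u'(2) by (auto simp: restr_def)
  qed
  from theI'[OF this, folded nodal_interp_def] show ?thesis using x by blast
qed

lemma weighted_ext_in:
  "closure \<Omega> = \<Union>\<T> \<Longrightarrow> weighted_ext \<Omega> \<T> p D \<eta> v \<in> fe_space \<Omega> \<T> p"
  by (simp add: weighted_ext_def zero_ext_in)

lemma weighted_ext_node:
  assumes "closure \<Omega> = \<Union>\<T>" "closure D \<subseteq> \<Union>{T\<in>\<T>. T \<subseteq> closure D}" "x \<in> fe_nodes \<T> p"
  shows "weighted_ext \<Omega> \<T> p D \<eta> v x = (if x \<in> closure D then of_real (\<eta> x) * v x else 0)"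
  using assms by (simp add: weighted_ext_def zero_ext_node nodal_interp_node)

lemma weighted_ext_add:
  assumes "closure \<Omega> = \<Union>\<T>" "closure D \<subseteq> \<Union>{T\<in>\<T>. T \<subseteq> closure D}"
  shows "weighted_ext \<Omega> \<T> p D \<eta> (\<lambda>x. v x + w x) =
    (\<lambda>x. weighted_ext \<Omega> \<T> p D \<eta> v x + weighted_ext \<Omega> \<T> p D \<eta> w x)"
  by (rule fe_space_eqI[OF assms(1)])
    (simp_all add: assms weighted_ext_in fe_space_add weighted_ext_node distrib_left)

text \<open>A weight vanishes at every node outside the closure of its subdomain, exactly where the zero extension
  removes the value. So at each node the sum is \<open>u\<close> times the sum of all weights.\<close>

lemma sum_weighted_ext:
  assumes closure: "closure \<Omega> = \<Union>\<T>"
    and cells: "\<And>j. j \<in> {1..N} \<Longrightarrow> closure (\<Omega>s j) \<subseteq> \<Union>{T\<in>\<T>. T \<subseteq> closure (\<Omega>s j)}"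
    and unity: "partition_of_unity \<Omega> N \<Omega>s \<eta>" and u: "u \<in> fe_space \<Omega> \<T> p"
  shows "(\<lambda>x. \<Sum>j\<in>{1..N}. weighted_ext \<Omega> \<T> p (\<Omega>s j) (\<eta> j) (restr (closure (\<Omega>s j)) u) x) = u"
proof (rule fe_space_eqI[OF closure _ u])
  show "(\<lambda>x. \<Sum>j\<in>{1..N}. weighted_ext \<Omega> \<T> p (\<Omega>s j) (\<eta> j) (restr (closure (\<Omega>s j)) u) x) \<in> fe_space \<Omega> \<T> p"
    by (intro fe_space_sum weighted_ext_in closure)
  fix x assume x: "x \<in> fe_nodes \<T> p"
  then obtain T where T: "T \<in> \<T>" "x \<in> lagrange_nodes p T" by (auto simp: fe_nodes_def)
  then have "x \<in> T" using lattice_of_lagrange_node by blast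
  then have x\<Omega>: "x \<in> closure \<Omega>" using T(1) closure by blast
  have "(\<Sum>j\<in>{1..N}. weighted_ext \<Omega> \<T> p (\<Omega>s j) (\<eta> j) (restr (closure (\<Omega>s j)) u) x) =
      (\<Sum>j\<in>{1..N}. of_real (\<eta> j x) * u x)"
  proof (rule sum.cong[OF refl])
    fix j assume j: "j \<in> {1..N}"
    have "\<eta> j x = 0" if "x \<notin> closure (\<Omega>s j)"
    proof (rule ccontr)
      assume "\<eta> j x \<noteq> 0"
      then have "x \<in> {x \<in> closure \<Omega>. \<eta> j x \<noteq> 0}" using x\<Omega> by simp
      then have "x \<in> closure {x \<in> closure \<Omega>. \<eta> j x \<noteq> 0}" by (rule subsetD[OF closure_subset])
      moreover have "closure {x \<in> closure \<Omega>. \<eta> j x \<noteq> 0} \<subseteq> closure (\<Omega>s j)"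
        using unity j by (simp add: partition_of_unity_def)
      ultimately show False using that by (simp add: subset_iff)
    qed
    then show "weighted_ext \<Omega> \<T> p (\<Omega>s j) (\<eta> j) (restr (closure (\<Omega>s j)) u) x = of_real (\<eta> j x) * u x"
      using weighted_ext_node[OF closure cells[OF j] x] by (auto simp: restr_def)
  qed
  also have "\<dots> = of_real (\<Sum>j\<in>{1..N}. \<eta> j x) * u x" by (simp add: sum_distrib_right)
  also have "\<dots> = u x" using unity x\<Omega> by (simp add: partition_of_unity_def)
  finally show "(\<Sum>j\<in>{1..N}. weighted_ext \<Omega> \<T> p (\<Omega>s j) (\<eta> j) (restr (closure (\<Omega>s j)) u) x) = u x" .
qed

end

section \<open>Subdomains resolved by the mesh\<close>

context simplicial_mesh
begin

definition skeleton :: "(real^'n) set" where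
  "skeleton = (\<Union>T\<in>\<T>. frontier T)"

lemma negligible_skeleton: "negligible skeleton"
  unfolding skeleton_def
  using finite_mesh convex_cell by (intro negligible_Union) (auto intro: negligible_convex_frontier)

lemma interior_of_cell:
  assumes "x \<in> \<Union>\<T>" "x \<notin> skeleton"
  obtains T where "T \<in> \<T>" "x \<in> interior T"
proof -
  obtain T where T: "T \<in> \<T>" "x \<in> T" using assms by blast
  then have "x \<notin> frontier T" using assms by (auto simp: skeleton_def)
  then have "x \<in> interior T" using T closure_subset by (auto simp: frontier_def)
  then show ?thesis using that T by blast
qed

text \<open>If they met, the two simplices would intersect in a common face that contains an interior point of the second, so the second would be a face
  of the first and, having full dimension, equal to it. But a facet misses the interior of its own simplex.\<close>

lemma facet_disjoint_interior:
  assumes T: "T \<in> \<T>" and T': "T' \<in> \<T>" and F: "F facet_of T'"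
  shows "F \<inter> interior T = {}"
proof (rule ccontr)
  assume "F \<inter> interior T \<noteq> {}"
  then obtain y where y: "y \<in> F" "y \<in> interior T" by blast
  have FT: "F face_of T'" "F \<noteq> T'" using F by (auto simp: facet_of_def)
  then have "y \<in> T \<inter> T'" using y interior_subset face_of_imp_subset by blast
  then have "(T \<inter> T') \<inter> interior T \<noteq> {}" using y by blast
  then have "T \<inter> T' = T" using face_of_disjoint_interior[OF face_cell[OF T T']] by blast
  then have "T face_of T'" using face_cell[OF T' T] by (simp add: Int_commute)
  moreover have "aff_dim T = aff_dim T'"
    using aff_dim_simplex[OF full_simplex[OF T]] aff_dim_simplex[OF full_simplex[OF T']] by simp
  ultimately have "T = T'"
    using face_of_aff_dim_lt[of T' T] convex_cell[OF T'] by force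
  then show False using face_of_disjoint_interior[OF FT(1)] FT(2) y by blast
qed

text \<open>The interior of a simplex is connected and, by the previous lemma, misses the frontier of the subdomain, so it lies
  inside or outside. The points of the subdomain off the skeleton are dense in its closure, because a
  null set has empty interior.\<close>

lemma resolved_closure_is_union_of_cells:
  assumes D: "open D" "D \<subseteq> \<Union>\<T>" and res: "resolves_boundary \<T> D"
  shows "closure D \<subseteq> \<Union>{T\<in>\<T>. T \<subseteq> closure D}"
proof -
  let ?U = "\<Union>{T\<in>\<T>. T \<subseteq> closure D}"
  have cell: "D - skeleton \<subseteq> ?U"
  proof
    fix y assume y: "y \<in> D - skeleton"
    then obtain T where T: "T \<in> \<T>" "y \<in> interior T"
      using interior_of_cell[of y] D by blast
    obtain \<F> where \<F>: "\<forall>F\<in>\<F>. \<exists>T\<in>\<T>. F facet_of T" "frontier D = \<Union>\<F>"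
      using res unfolding resolves_boundary_def by blast
    have "interior T \<inter> frontier D = {}"
      using \<F> facet_disjoint_interior[OF T(1)] by blast
    moreover have "connected (interior T)"
      using convex_cell[OF T(1)] by (intro convex_connected convex_interior)
    ultimately have "interior T \<subseteq> D"
      using connected_Int_frontier[of "interior T" D] T y by blast
    then have "closure (interior T) \<subseteq> closure D" by (rule closure_mono)
    moreover have "closure (interior T) = closure T"
      using convex_closure_interior[OF convex_cell[OF T(1)]] T(2) by blast
    ultimately have "T \<subseteq> closure D" using closure_subset by blast
    moreover have "y \<in> T" using T interior_subset by blast
    ultimately show "y \<in> ?U" using T(1) by blast
  qed
  have "interior skeleton = {}"
    using open_not_negligible negligible_subset[OF negligible_skeleton] interior_subset open_interior
    by metis
  then have "closure (D \<inter> - skeleton) = closure D"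
    using D by (intro closure_open_Int_superset) (simp_all add: closure_complement)
  moreover have "closed ?U"
    using finite_mesh compact_cell compact_imp_closed by (intro closed_Union) auto
  ultimately show ?thesis
    using cell closure_minimal[of "D \<inter> - skeleton" ?U] by (simp add: Diff_eq)
qed

end

section \<open>Finiteness of the surface measure\<close>

text \<open>A convenient sufficient condition for a finite outer measure: finite coverings can be united and transported by
  Lipschitz maps set by set.\<close>

definition finite_content :: "nat \<Rightarrow> 'a::metric_space set \<Rightarrow> bool" where
  "finite_content s A \<longleftrightarrow> (\<exists>B::real. \<forall>\<delta>>0. \<exists>\<U>. finite \<U> \<and> A \<subseteq> \<Union>\<U> \<and>
     (\<forall>U\<in>\<U>. bounded U \<and> diameter U \<le> \<delta>) \<and> (\<Sum>U\<in>\<U>. diameter U ^ s) \<le> B)"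

lemma finite_content_subset:
  assumes "finite_content s A" "A' \<subseteq> A"
  shows "finite_content s A'"
  using assms unfolding finite_content_def by (meson subset_trans)

lemma finite_content_Un:
  assumes "finite_content s A" "finite_content s A'"
  shows "finite_content s (A \<union> A')"
proof -
  obtain B B' where
    B: "\<And>\<delta>. \<delta> > 0 \<Longrightarrow> \<exists>\<U>. finite \<U> \<and> A \<subseteq> \<Union>\<U> \<and>
      (\<forall>U\<in>\<U>. bounded U \<and> diameter U \<le> \<delta>) \<and> (\<Sum>U\<in>\<U>. diameter U ^ s) \<le> B" and
    B': "\<And>\<delta>. \<delta> > 0 \<Longrightarrow> \<exists>\<U>. finite \<U> \<and> A' \<subseteq> \<Union>\<U> \<and>
      (\<forall>U\<in>\<U>. bounded U \<and> diameter U \<le> \<delta>) \<and> (\<Sum>U\<in>\<U>. diameter U ^ s) \<le> B'"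
    using assms unfolding finite_content_def by blast
  have "\<exists>\<W>. finite \<W> \<and> A \<union> A' \<subseteq> \<Union>\<W> \<and>
      (\<forall>U\<in>\<W>. bounded U \<and> diameter U \<le> \<delta>) \<and> (\<Sum>U\<in>\<W>. diameter U ^ s) \<le> B + B'"
    if \<delta>: "\<delta> > 0" for \<delta>
  proof -
    obtain \<U> \<U>' where U: "finite \<U>" "A \<subseteq> \<Union>\<U>" "\<forall>U\<in>\<U>. bounded U \<and> diameter U \<le> \<delta>"
        "(\<Sum>U\<in>\<U>. diameter U ^ s) \<le> B"
      and U': "finite \<U>'" "A' \<subseteq> \<Union>\<U>'" "\<forall>U\<in>\<U>'. bounded U \<and> diameter U \<le> \<delta>"
        "(\<Sum>U\<in>\<U>'. diameter U ^ s) \<le> B'"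
      using B[OF \<delta>] B'[OF \<delta>] by metis
    have "(\<Sum>U\<in>\<U> \<union> \<U>'. diameter U ^ s) + (\<Sum>U\<in>\<U> \<inter> \<U>'. diameter U ^ s)
        = (\<Sum>U\<in>\<U>. diameter U ^ s) + (\<Sum>U\<in>\<U>'. diameter U ^ s)"
      using U(1) U'(1) by (rule sum.union_inter)
    moreover have "0 \<le> (\<Sum>U\<in>\<U> \<inter> \<U>'. diameter U ^ s)"
      using U(3) by (intro sum_nonneg zero_le_power) (auto intro: diameter_ge_0)
    ultimately show ?thesis
      using U U' by (intro exI[of _ "\<U> \<union> \<U>'"]) auto
  qed
  then show ?thesis unfolding finite_content_def by (intro exI[of _ "B + B'"]) auto
qed

lemma finite_content_empty: "finite_content s {}"
  unfolding finite_content_def by (intro exI[of _ 0] allI impI exI[of _ "{}"]) simp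

lemma finite_content_Union:
  assumes "finite \<A>" "\<And>A. A \<in> \<A> \<Longrightarrow> finite_content s A"
  shows "finite_content s (\<Union>\<A>)"
  using assms by (induction \<A>) (simp_all add: finite_content_empty finite_content_Un)

lemma finite_content_lipschitz_image:
  fixes h :: "'a::metric_space \<Rightarrow> 'b::real_normed_vector"
  assumes A: "finite_content s A" and h: "L-lipschitz_on A h"
  shows "finite_content s (h ` A)"
proof -
  \<comment> \<open>a positive Lipschitz constant, so that the covering may be chosen for the scale \<open>\<delta> / M\<close>\<close>
  define M where "M = max L 1"
  have M: "M > 0" "L \<le> M" by (auto simp: M_def)
  have hM: "dist (h x) (h y) \<le> M * dist x y" if "x \<in> A" "y \<in> A" for x y
    using lipschitz_onD[OF h that] mult_right_mono[OF M(2), of "dist x y"] by simp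
  obtain B where
    B: "\<And>\<delta>. \<delta> > 0 \<Longrightarrow> \<exists>\<U>. finite \<U> \<and> A \<subseteq> \<Union>\<U> \<and>
      (\<forall>U\<in>\<U>. bounded U \<and> diameter U \<le> \<delta>) \<and> (\<Sum>U\<in>\<U>. diameter U ^ s) \<le> B"
    using A unfolding finite_content_def by blast
  have "\<exists>\<W>. finite \<W> \<and> h ` A \<subseteq> \<Union>\<W> \<and>
      (\<forall>U\<in>\<W>. bounded U \<and> diameter U \<le> \<delta>) \<and> (\<Sum>U\<in>\<W>. diameter U ^ s) \<le> M ^ s * B"
    if \<delta>: "\<delta> > 0" for \<delta>
  proof -
    obtain \<U> where U: "finite \<U>" "A \<subseteq> \<Union>\<U>" "\<And>U. U \<in> \<U> \<Longrightarrow> bounded U"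
        "\<And>U. U \<in> \<U> \<Longrightarrow> diameter U \<le> \<delta> / M" "(\<Sum>U\<in>\<U>. diameter U ^ s) \<le> B"
      using B[of "\<delta> / M"] \<delta> M(1) by (metis divide_pos_pos)
    let ?h = "\<lambda>U. h ` (U \<inter> A)"
    have d: "dist (h x) (h y) \<le> M * diameter U" if "U \<in> \<U>" "x \<in> U \<inter> A" "y \<in> U \<inter> A" for U x y
      using hM[of x y] diameter_bounded_bound[OF U(3)[OF that(1)], of x y] that M(1)
      by (meson IntD1 IntD2 mult_left_mono order_trans less_imp_le)
    have bnd: "bounded (?h U)" if "U \<in> \<U>" for U
      unfolding bounded_two_points using d[OF that] by blast
    have diam: "diameter (?h U) \<le> M * diameter U" if "U \<in> \<U>" for U
    proof (rule diameter_le)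
      show "?h U \<noteq> {} \<or> 0 \<le> M * diameter U"
        using M(1) diameter_ge_0[OF U(3)[OF that]] by simp
    qed (use d[OF that] in \<open>auto simp: dist_norm\<close>)
    have "(\<Sum>W\<in>?h ` \<U>. diameter W ^ s) \<le> (\<Sum>U\<in>\<U>. diameter (?h U) ^ s)"
      using sum_image_le[OF U(1), of "\<lambda>W. diameter W ^ s" ?h] diameter_ge_0[OF bnd] by simp
    also have "\<dots> \<le> (\<Sum>U\<in>\<U>. (M * diameter U) ^ s)"
      using diam diameter_ge_0[OF bnd] by (intro sum_mono power_mono) auto
    also have "\<dots> = M ^ s * (\<Sum>U\<in>\<U>. diameter U ^ s)"
      by (simp add: power_mult_distrib sum_distrib_left)
    also have "\<dots> \<le> M ^ s * B" using U(5) M(1) by (intro mult_left_mono) auto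
    finally have "(\<Sum>W\<in>?h ` \<U>. diameter W ^ s) \<le> M ^ s * B" .
    moreover have "diameter (?h U) \<le> \<delta>" if "U \<in> \<U>" for U
      using diam[OF that] mult_left_mono[OF U(4)[OF that], of M] M(1) by simp
    moreover have "h ` A \<subseteq> \<Union>(?h ` \<U>)" using U(2) by blast
    ultimately show ?thesis using U(1) bnd by (intro exI[of _ "?h ` \<U>"]) auto
  qed
  then show ?thesis unfolding finite_content_def by (intro exI[of _ "M ^ s * B"]) auto
qed

text \<open>In dimension \<open>d\<close> the piece is divided into \<open>m ^ (d - 1)\<close> boxes with a diameter of order
  \<open>1 / m\<close>, so the total content is bounded independently of \<open>m\<close>.\<close>

lemma finite_content_coordinate_hyperplane:
  fixes i :: "'n::finite"
  shows "finite_content (CARD('n) - 1) {z :: real^'n. z $ i = 0 \<and> (\<forall>j. \<bar>z $ j\<bar> < R)}"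
    (is "finite_content ?s ?H")
proof (cases "R > 0")
  case False
  then have "\<not> \<bar>z $ i\<bar> < R" for z :: "real^'n" using abs_ge_zero[of "z $ i"] by linarith
  then have "?H = {}" by blast
  then show ?thesis by (simp only: finite_content_empty)
next
  case R: True
  define C where "C = CARD('n) * (2 * R)"
  have C: "C > 0" using R by (simp add: C_def)
  have "\<exists>\<U>. finite \<U> \<and> ?H \<subseteq> \<Union>\<U> \<and> (\<forall>U\<in>\<U>. bounded U \<and> diameter U \<le> \<delta>) \<and>
      (\<Sum>U\<in>\<U>. diameter U ^ ?s) \<le> C ^ ?s" if \<delta>: "\<delta> > 0" for \<delta>
  proof -
    obtain m where m: "C / \<delta> < real m" using reals_Archimedean2 by blast
    have m0: "real m > 0" using m C \<delta> by (smt (verit) divide_pos_pos)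
    have m\<delta>: "C / m \<le> \<delta>" using m m0 \<delta> by (simp add: field_simps)
    define I where "I = PiE UNIV (\<lambda>j. if j = i then {0} else {..<m})"
    define box where "box \<xi> = {z :: real^'n. z $ i = 0 \<and>
        (\<forall>j. j \<noteq> i \<longrightarrow> 2 * R / m * real (\<xi> j) - R \<le> z $ j \<and> z $ j \<le> 2 * R / m * (real (\<xi> j) + 1) - R)}"
      for \<xi> :: "'n \<Rightarrow> nat"
    have finI: "finite I" unfolding I_def by (intro finite_PiE) auto
    have cardI: "card I = m ^ ?s"
    proof -
      have "card I = (\<Prod>j\<in>UNIV. if j = i then 1 else m)"
        unfolding I_def by (subst card_PiE) (auto intro!: prod.cong)
      also have "\<dots> = (\<Prod>j\<in>UNIV - {i}. if j = i then 1 else m)" by (simp add: prod.remove[of UNIV i])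
      also have "\<dots> = (\<Prod>j\<in>UNIV - {i}. m)" by (rule prod.cong) auto
      finally show ?thesis by simp
    qed
    have d: "dist x y \<le> C / m" if x: "x \<in> box \<xi>" and y: "y \<in> box \<xi>" for \<xi> x y
    proof -
      have "\<bar>(x - y) $ j\<bar> \<le> 2 * R / m" for j
      proof (cases "j = i")
        case False
        then have "2 * R / m * real (\<xi> j) - R \<le> x $ j" "x $ j \<le> 2 * R / m * (real (\<xi> j) + 1) - R"
          "2 * R / m * real (\<xi> j) - R \<le> y $ j" "y $ j \<le> 2 * R / m * (real (\<xi> j) + 1) - R"
          using x y by (auto simp: box_def)
        moreover have "2 * R / m * (real (\<xi> j) + 1) = 2 * R / m * real (\<xi> j) + 2 * R / m"
          by (simp add: distrib_left)
        ultimately show ?thesis by (simp add: abs_le_iff)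
      qed (use x y R in \<open>simp add: box_def\<close>)
      then have "(\<Sum>j\<in>UNIV. \<bar>(x - y) $ j\<bar>) \<le> (\<Sum>j\<in>(UNIV::'n set). 2 * R / m)" by (rule sum_mono)
      then show ?thesis using norm_le_l1_cart[of "x - y"] by (simp add: dist_norm C_def)
    qed
    have bnd: "bounded (box \<xi>)" for \<xi> unfolding bounded_two_points using d by blast
    have diam: "diameter (box \<xi>) \<le> C / m" for \<xi>
      using d C m0 by (intro diameter_le) (auto simp: dist_norm)
    have cover: "?H \<subseteq> \<Union>(box ` I)"
    proof
      fix z assume z: "z \<in> ?H"
      \<comment> \<open>the cell containing \<open>z\<close>: the side \<open>[-R, R)\<close> rescaled to \<open>[0, m)\<close> and rounded down\<close>
      define t where "t j = (z $ j + R) * m / (2 * R)" for j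
      have t: "0 \<le> t j" "t j < m" for j
      proof -
        have "\<bar>z $ j\<bar> < R" using z by simp
        then have "0 \<le> z $ j + R" "z $ j + R < 2 * R" by linarith+
        then have "0 \<le> (z $ j + R) * m" "(z $ j + R) * m < 2 * R * m"
          using m0 by (simp_all only: mult_nonneg_nonneg less_imp_le mult_strict_right_mono)
        then show "0 \<le> t j" "t j < m"
          using R by (simp_all add: t_def pos_divide_less_eq mult.commute)
      qed
      define \<xi> where "\<xi> j = (if j = i then 0 else nat \<lfloor>t j\<rfloor>)" for j
      have "nat \<lfloor>t j\<rfloor> < m" for j using t[of j] by linarith
      then have "\<xi> \<in> I" by (auto simp: I_def \<xi>_def)
      moreover have "z \<in> box \<xi>"
        unfolding box_def
      proof (intro CollectI conjI allI impI)
        show "z $ i = 0" using z by simp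
        fix j assume j: "j \<noteq> i"
        have f: "real (nat \<lfloor>t j\<rfloor>) \<le> t j" "t j \<le> real (nat \<lfloor>t j\<rfloor>) + 1"
          using t(1)[of j] by linarith+
        have zt: "z $ j = 2 * R / m * t j - R" using R m0 by (simp add: t_def field_simps)
        show "2 * R / m * real (\<xi> j) - R \<le> z $ j" "z $ j \<le> 2 * R / m * (real (\<xi> j) + 1) - R"
          using j R m0 f unfolding zt \<xi>_def by (auto intro!: mult_left_mono divide_right_mono)
      qed
      ultimately show "z \<in> \<Union>(box ` I)" by blast
    qed
    have "(\<Sum>U\<in>box ` I. diameter U ^ ?s) \<le> (\<Sum>\<xi>\<in>I. diameter (box \<xi>) ^ ?s)"
      using sum_image_le[OF finI, of "\<lambda>U. diameter U ^ ?s" box] diameter_ge_0[OF bnd] by simp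
    also have "\<dots> \<le> (\<Sum>\<xi>\<in>I. (C / m) ^ ?s)"
      using diam diameter_ge_0[OF bnd] by (intro sum_mono power_mono) auto
    also have "\<dots> = C ^ ?s" using m0 by (simp add: cardI power_divide)
    finally show ?thesis using finI cover bnd diam m\<delta>
      by (intro exI[of _ "box ` I"]) (auto intro: order_trans)
  qed
  then show ?thesis unfolding finite_content_def by (intro exI[of _ "C ^ ?s"]) auto
qed

text \<open>A finite covering is turned into a sequence by padding with empty sets, whose size is zero even if \<open>s = 0\<close>.\<close>

lemma hausdorff_outer_finite:
  assumes "finite_content s A"
  shows "hausdorff_outer s A < \<infinity>"
proof -
  obtain B where
    B: "\<And>\<delta>. \<delta> > 0 \<Longrightarrow> \<exists>\<U>. finite \<U> \<and> A \<subseteq> \<Union>\<U> \<and>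
      (\<forall>U\<in>\<U>. bounded U \<and> diameter U \<le> \<delta>) \<and> (\<Sum>U\<in>\<U>. diameter U ^ s) \<le> B"
    using assms unfolding finite_content_def by blast
  define K where "K = unit_ball_vol (real s) / 2 ^ s"
  have K: "K \<ge> 0" by (simp add: K_def)
  have "hausdorff_outer s A \<le> ennreal (K * B)"
    unfolding hausdorff_outer_def
  proof (rule SUP_least)
    fix \<delta> :: real assume "\<delta> \<in> {0<..}"
    then obtain \<U> where U: "finite \<U>" "A \<subseteq> \<Union>\<U>" "\<And>U. U \<in> \<U> \<Longrightarrow> bounded U \<and> diameter U \<le> \<delta>"
        "(\<Sum>U\<in>\<U>. diameter U ^ s) \<le> B"
      using B[of \<delta>] by auto
    obtain e where e: "bij_betw e {..<card \<U>} \<U>"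
      using bij_betw_from_nat_into_finite[OF U(1)] by blast
    define V where "V i = (if i < card \<U> then e i else {})" for i
    have V: "V i \<in> insert {} \<U>" for i using bij_betwE[OF e] by (auto simp: V_def)
    have "(INF U\<in>{U :: nat \<Rightarrow> 'a set. A \<subseteq> (\<Union>i. U i) \<and> (\<forall>i. bounded (U i) \<and> diameter (U i) \<le> \<delta>)}.
        \<Sum>i. hausdorff_size s (U i)) \<le> (\<Sum>i. hausdorff_size s (V i))"
    proof (rule INF_lower, intro CollectI conjI allI)
      have "\<Union>\<U> \<subseteq> (\<Union>i. V i)"
      proof
        fix x assume "x \<in> \<Union>\<U>"
        then obtain i where "i < card \<U>" "x \<in> e i"
          using bij_betw_imp_surj_on[OF e] by (metis UnionE imageE lessThan_iff)
        then show "x \<in> (\<Union>i. V i)" by (auto simp: V_def)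
      qed
      from U(2) this show "A \<subseteq> (\<Union>i. V i)" by (rule subset_trans)
      fix i
      show "bounded (V i)" "diameter (V i) \<le> \<delta>"
        using V[of i] U(3)[of "V i"] \<open>\<delta> \<in> {0<..}\<close> by auto
    qed
    also have "(\<Sum>i. hausdorff_size s (V i)) = (\<Sum>i<card \<U>. hausdorff_size s (V i))"
      by (rule suminf_finite) (auto simp: V_def hausdorff_size_def)
    also have "\<dots> = (\<Sum>i<card \<U>. hausdorff_size s (e i))" by (simp add: V_def)
    also have "\<dots> = (\<Sum>U\<in>\<U>. hausdorff_size s U)" by (rule sum.reindex_bij_betw[OF e])
    also have "\<dots> \<le> (\<Sum>U\<in>\<U>. ennreal (K * diameter U ^ s))"
      by (rule sum_mono) (simp add: hausdorff_size_def K_def power_divide)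
    also have "\<dots> = ennreal (\<Sum>U\<in>\<U>. K * diameter U ^ s)"
      using K U(3) by (intro sum_ennreal) (simp add: diameter_ge_0)
    also have "\<dots> \<le> ennreal (K * B)"
      using K U(4) by (intro ennreal_leI) (simp add: mult_left_mono flip: sum_distrib_left)
    finally show "(INF U\<in>{U :: nat \<Rightarrow> 'a set. A \<subseteq> (\<Union>i. U i) \<and> (\<forall>i. bounded (U i) \<and> diameter (U i) \<le> \<delta>)}.
        \<Sum>i. hausdorff_size s (U i)) \<le> ennreal (K * B)" .
  qed
  then show ?thesis by (simp add: order_le_less_trans)
qed

text \<open>Locally the frontier lies in the graph of a Lipschitz function over the hyperplane orthogonal to \<open>e\<close>,
  and an orthogonal map takes that hyperplane to a coordinate hyperplane.\<close>

lemma finite_content_frontier: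
  fixes D :: "(real^'n::finite) set"
  assumes D: "open D" "bounded D" "lipschitz_boundary D"
  shows "finite_content (CARD('n) - 1) (frontier D)"
proof -
  fix i :: 'n
  let ?s = "CARD('n) - 1"
  have local: "\<exists>r>0. finite_content ?s (frontier D \<inter> ball x r)" if x: "x \<in> frontier D" for x
  proof -
    obtain e r L \<gamma> where e: "norm e = 1" and r: "r > 0" and \<gamma>: "L-lipschitz_on UNIV \<gamma>"
      and epi: "\<forall>y\<in>ball x r. y \<in> D \<longleftrightarrow> y \<bullet> e > \<gamma> (y - (y \<bullet> e) *\<^sub>R e)"
      using D(3) x unfolding lipschitz_boundary_def by blast
    define P where "P y = y - (y \<bullet> e) *\<^sub>R e" for y
    have contP: "continuous_on UNIV (\<lambda>y. \<gamma> (P y))"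
      unfolding P_def
      by (intro continuous_on_compose2[OF lipschitz_on_continuous_on[OF \<gamma>]] continuous_intros) auto
    have graph: "y \<bullet> e = \<gamma> (P y)" if y: "y \<in> frontier D" "y \<in> ball x r" for y
    proof -
      have "y \<notin> D" using y D(1) by (simp add: frontier_def interior_open)
      then have "y \<bullet> e \<le> \<gamma> (P y)" using epi y by (auto simp: P_def)
      moreover have "\<not> y \<bullet> e < \<gamma> (P y)"
      proof
        assume less: "y \<bullet> e < \<gamma> (P y)"
        \<comment> \<open>strictly below the graph there is an open set that misses \<open>D\<close>, so no frontier point\<close>
        let ?W = "ball x r \<inter> {y. y \<bullet> e < \<gamma> (P y)}"
        have "open ?W"
          by (intro open_Int open_ball open_Collect_less contP continuous_intros)
        moreover have "?W \<inter> D = {}" using epi by (auto simp: P_def)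
        ultimately have "?W \<inter> closure D = {}" by (simp add: open_Int_closure_eq_empty)
        then show False using y less by (auto simp: frontier_def)
      qed
      ultimately show ?thesis by simp
    qed
    obtain A where A: "orthogonal_transformation A" "A (axis i (1::real)) = e"
      using orthogonal_transformation_exists_1[OF norm_axis_1[of i] e] by blast
    define h where "h z = A z + \<gamma> (A z) *\<^sub>R e" for z
    have Adist: "dist (A z) (A z') = dist z z'" for z z'
      using A(1) by (metis orthogonal_transformation_isometry)
    have "(1 + L)-lipschitz_on UNIV h"
    proof (rule lipschitz_onI)
      show "0 \<le> 1 + L" using lipschitz_on_nonneg[OF \<gamma>] by simp
      fix z z'
      have "dist (h z) (h z') \<le> dist (A z) (A z') + dist (\<gamma> (A z) *\<^sub>R e) (\<gamma> (A z') *\<^sub>R e)"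
        unfolding h_def by (rule dist_triangle_add)
      also have "dist (\<gamma> (A z) *\<^sub>R e) (\<gamma> (A z') *\<^sub>R e) = dist (\<gamma> (A z)) (\<gamma> (A z'))"
        using e by (simp add: dist_norm flip: scaleR_diff_left)
      also have "\<dots> \<le> L * dist (A z) (A z')" using lipschitz_onD[OF \<gamma>] by blast
      finally show "dist (h z) (h z') \<le> (1 + L) * dist z z'" by (simp add: Adist algebra_simps)
    qed
    \<comment> \<open>the projection does not increase the norm, so \<open>R\<close> bounds the parameters of all points of the ball\<close>
    define R where "R = norm x + r + 1"
    let ?H = "{z :: real^'n. z $ i = 0 \<and> (\<forall>j. \<bar>z $ j\<bar> < R)}"
    have "(1 + L)-lipschitz_on ?H h"
      using \<open>(1 + L)-lipschitz_on UNIV h\<close> by (rule lipschitz_on_subset) simp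
    from finite_content_lipschitz_image[OF finite_content_coordinate_hyperplane this]
    have "finite_content ?s (h ` ?H)" .
    moreover have "frontier D \<inter> ball x r \<subseteq> h ` ?H"
    proof
      fix y assume y: "y \<in> frontier D \<inter> ball x r"
      obtain z where z: "A z = P y"
        using orthogonal_transformation_surj[OF A(1)] by (metis surjD)
      have "z $ i = z \<bullet> axis i 1" by (simp add: inner_axis)
      also have "\<dots> = A z \<bullet> A (axis i 1)" using A(1) by (simp add: orthogonal_transformation_def)
      also have "\<dots> = 0"
        using e by (simp add: z A(2) P_def inner_diff_left norm_eq_1)
      finally have "z $ i = 0" .
      moreover have "\<bar>z $ j\<bar> < R" for j
      proof -
        have Pe: "P y \<bullet> e = 0" using e by (simp add: P_def inner_diff_left norm_eq_1)
        have "P y \<bullet> P y = P y \<bullet> y - (y \<bullet> e) * (P y \<bullet> e)"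
          by (subst (2) P_def) (simp add: inner_diff_right)
        then have "(norm (P y))\<^sup>2 = P y \<bullet> y" by (simp add: Pe power2_norm_eq_inner)
        also have "\<dots> \<le> norm (P y) * norm y" by (rule norm_cauchy_schwarz)
        finally have "norm (P y) \<le> norm y"
          by (cases "P y = 0") (simp_all add: power2_eq_square)
        then have "norm z \<le> norm y"
          using A(1) z by (metis orthogonal_transformation_norm)
        moreover have "norm y \<le> norm x + dist x y"
          by (metis dist_commute dist_norm norm_triangle_sub)
        ultimately show ?thesis
          using component_le_norm_cart[of z j] y by (simp add: R_def)
      qed
      moreover have "y = h z"
        using graph[of y] y by (simp add: h_def z) (simp add: P_def)
      ultimately show "y \<in> h ` ?H" by blast
    qed
    ultimately have "finite_content ?s (frontier D \<inter> ball x r)" by (rule finite_content_subset)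
    then show ?thesis using r by blast
  qed
  then obtain r where r: "\<And>x. x \<in> frontier D \<Longrightarrow> r x > 0 \<and> finite_content ?s (frontier D \<inter> ball x (r x))"
    by metis
  have "compact (frontier D)" using D(2) by (rule compact_frontier_bounded)
  then obtain X where X: "X \<subseteq> frontier D" "finite X" "frontier D \<subseteq> (\<Union>x\<in>X. ball x (r x))"
  proof (rule compactE_image[of _ "frontier D" "\<lambda>x. ball x (r x)"])
    show "frontier D \<subseteq> (\<Union>x\<in>frontier D. ball x (r x))" using r by fastforce
  qed auto
  have "finite_content ?s (\<Union>((\<lambda>x. frontier D \<inter> ball x (r x)) ` X))"
    using X r by (intro finite_content_Union) auto
  then show ?thesis by (rule finite_content_subset) (use X in blast)
qed

lemma borel_sets_surface_measure: "sets borel \<subseteq> sets surface_measure"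
  unfolding surface_measure_def hausdorff_measure_def
  by (auto intro!: sets_completionI_sets simp: sets_measure_of_conv)

lemma space_surface_measure: "space surface_measure = UNIV"
  by (simp add: surface_measure_def hausdorff_measure_def space_measure_of_conv)

text \<open>By definition \<^const>\<open>measure_of\<close> either takes the values of the outer measure or, if these do not form a measure, is
  the null measure; both are bounded by the outer measure.\<close>

lemma emeasure_surface_le:
  assumes "A \<in> sets borel"
  shows "emeasure (surface_measure :: (real^'n) measure) A \<le> hausdorff_outer (CARD('n) - 1) A"
proof -
  let ?M = "measure_of UNIV (sets borel) (hausdorff_outer (CARD('n) - 1)) :: (real^'n) measure"
  have "A \<in> sets ?M" using assms by (simp add: sets_measure_of_conv)
  then have "emeasure surface_measure A = emeasure ?M A"
    by (simp add: surface_measure_def hausdorff_measure_def)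
  also have "\<dots> \<le> hausdorff_outer (CARD('n) - 1) A" by (simp add: emeasure_measure_of_conv)
  finally show ?thesis .
qed

lemma emeasure_surface_frontier_finite:
  fixes D :: "(real^'n::finite) set"
  assumes "open D" "bounded D" "lipschitz_boundary D"
  shows "emeasure surface_measure (frontier D) < \<infinity>"
  using emeasure_surface_le[of "frontier D"] hausdorff_outer_finite[OF finite_content_frontier[OF assms]]
  by (simp add: order_le_less_trans)

section \<open>Integrability of the terms of the forms\<close>

lemma set_integrable_square_integrable_mult_bounded:
  fixes f v :: "'a \<Rightarrow> complex"
  assumes A: "A \<in> sets M" "emeasure M A < \<infinity>" and f: "square_integrable_on M A f"
    and v: "set_borel_measurable M A v" "\<And>x. x \<in> A \<Longrightarrow> cmod (v x) \<le> B"
  shows "set_integrable M A (\<lambda>x. f x * cnj (v x))"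
proof (rule set_integrable_bound)
  show "set_integrable M A (\<lambda>x. (cmod (f x))\<^sup>2 + B\<^sup>2)"
    using f A by (intro set_integral_add) (auto simp: square_integrable_on_def set_integrable_def)
  have "(\<lambda>x. (indicator A x *\<^sub>R f x) * cnj (indicator A x *\<^sub>R v x)) \<in> borel_measurable M"
    using f v(1) unfolding square_integrable_on_def set_borel_measurable_def
    by (intro borel_measurable_times
        measurable_compose[OF _ borel_measurable_continuous_onI[OF continuous_on_cnj[OF continuous_on_id]]]) auto
  moreover have "(\<lambda>x. (indicator A x *\<^sub>R f x) * cnj (indicator A x *\<^sub>R v x)) =
      (\<lambda>x. indicator A x *\<^sub>R (f x * cnj (v x)))"
    by (auto simp: indicator_def)
  ultimately show "set_borel_measurable M A (\<lambda>x. f x * cnj (v x))"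
    by (simp add: set_borel_measurable_def)
  have "norm (f x * cnj (v x)) \<le> norm ((cmod (f x))\<^sup>2 + B\<^sup>2)" if "x \<in> A" for x
  proof -
    have "2 * (cmod (f x) * cmod (v x)) \<le> (cmod (f x))\<^sup>2 + (cmod (v x))\<^sup>2"
      using sum_squares_bound[of "cmod (f x)" "cmod (v x)"] by simp
    moreover have "(cmod (v x))\<^sup>2 \<le> B\<^sup>2" using v(2)[OF that] by (intro power_mono) auto
    moreover have "0 \<le> cmod (f x) * cmod (v x)" by simp
    ultimately have "cmod (f x) * cmod (v x) \<le> (cmod (f x))\<^sup>2 + B\<^sup>2" by linarith
    then show ?thesis by (simp add: norm_mult)
  qed
  then show "AE x in M. x \<in> A \<longrightarrow> norm (f x * cnj (v x)) \<le> norm ((cmod (f x))\<^sup>2 + B\<^sup>2)" by simp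
qed

lemma continuous_on_set_borel_measurable:
  fixes v :: "'a::topological_space \<Rightarrow> complex"
  assumes "sets borel \<subseteq> sets M" "space M = UNIV" "A \<in> sets borel" "continuous_on A v"
  shows "set_borel_measurable M A v"
  unfolding set_borel_measurable_def
  using assms borel_measurable_subalgebra[OF assms(1) _ borel_measurable_continuous_on_indicator]
  by simp

lemma set_integrable_square_integrable_mult_continuous:
  fixes f v :: "'a::euclidean_space \<Rightarrow> complex"
  assumes M: "sets borel \<subseteq> sets M" "space M = UNIV" and A: "A \<in> sets borel" "emeasure M A < \<infinity>"
    and f: "square_integrable_on M A f" and K: "compact K" "A \<subseteq> K" and v: "continuous_on K v"
  shows "set_integrable M A (\<lambda>x. f x * cnj (v x))"
proof -
  obtain B where B: "\<And>x. x \<in> K \<Longrightarrow> norm (v x) \<le> B"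
    using compact_imp_bounded[OF compact_continuous_image[OF v K(1)]] by (auto simp: bounded_iff)
  show ?thesis
    using A M f K continuous_on_set_borel_measurable[OF M A(1) continuous_on_subset[OF v K(2)]] B
    by (intro set_integrable_square_integrable_mult_bounded[where B = B]) auto
qed

lemma square_integrable_on_continuous:
  fixes v :: "'a::euclidean_space \<Rightarrow> complex"
  assumes M: "sets borel \<subseteq> sets M" "space M = UNIV" and A: "A \<in> sets borel" "emeasure M A < \<infinity>"
    and K: "compact K" "A \<subseteq> K" and v: "continuous_on K v"
  shows "square_integrable_on M A v"
  unfolding square_integrable_on_def
proof
  show vm: "set_borel_measurable M A v"
    using continuous_on_set_borel_measurable[OF M A(1) continuous_on_subset[OF v K(2)]] .
  obtain B where B: "\<And>x. x \<in> K \<Longrightarrow> norm (v x) \<le> B"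
    using compact_imp_bounded[OF compact_continuous_image[OF v K(1)]] by (auto simp: bounded_iff)
  show "set_integrable M A (\<lambda>x. (cmod (v x))\<^sup>2)"
  proof (rule set_integrable_bound)
    show "set_integrable M A (\<lambda>x. B\<^sup>2)" using A M by (auto simp: set_integrable_def)
    have "(\<lambda>x. (cmod (indicator A x *\<^sub>R v x))\<^sup>2) \<in> borel_measurable M"
      using vm unfolding set_borel_measurable_def by measurable
    moreover have "(\<lambda>x. (cmod (indicator A x *\<^sub>R v x))\<^sup>2) = (\<lambda>x. indicator A x *\<^sub>R (cmod (v x))\<^sup>2)"
      by (auto simp: indicator_def)
    ultimately show "set_borel_measurable M A (\<lambda>x. (cmod (v x))\<^sup>2)"
      by (simp add: set_borel_measurable_def)
    have "norm ((cmod (v x))\<^sup>2) \<le> norm (B\<^sup>2)" if "x \<in> A" for x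
      using B[of x] that K(2) by (auto intro!: power_mono)
    then show "AE x in M. x \<in> A \<longrightarrow> norm ((cmod (v x))\<^sup>2) \<le> norm (B\<^sup>2)" by simp
  qed
qed

lemma surface_integrable:
  fixes D :: "(real^'n::finite) set"
  assumes D: "lipschitz_polyhedral D" and g: "square_integrable_on surface_measure (frontier D) g"
    and v: "continuous_on (closure D) v"
  shows "set_integrable surface_measure (frontier D) (\<lambda>x. g x * cnj (v x))"
proof (rule set_integrable_square_integrable_mult_continuous[OF borel_sets_surface_measure space_surface_measure _ _ g])
  show "emeasure surface_measure (frontier D) < \<infinity>"
    using D by (intro emeasure_surface_frontier_finite) (auto simp: lipschitz_polyhedral_def)
  show "compact (closure D)" using D by (simp add: lipschitz_polyhedral_def)
  show "frontier D \<subseteq> closure D" by (simp add: frontier_def)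
qed (use v in auto)

lemma surface_integrable_continuous:
  fixes D :: "(real^'n::finite) set"
  assumes D: "lipschitz_polyhedral D" and v: "continuous_on (closure D) v" and w: "continuous_on (closure D) w"
  shows "set_integrable surface_measure (frontier D) (\<lambda>x. v x * cnj (w x))"
proof (rule surface_integrable[OF D _ w])
  show "square_integrable_on surface_measure (frontier D) v"
  proof (rule square_integrable_on_continuous[OF borel_sets_surface_measure space_surface_measure _ _ _ _ v])
    show "emeasure surface_measure (frontier D) < \<infinity>"
      using D by (intro emeasure_surface_frontier_finite) (auto simp: lipschitz_polyhedral_def)
    show "compact (closure D)" using D by (simp add: lipschitz_polyhedral_def)
    show "frontier D \<subseteq> closure D" by (simp add: frontier_def)
  qed auto
qed

lemma volume_load_integrable:
  fixes D :: "(real^'n::finite) set"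
  assumes D: "lipschitz_polyhedral D" and f: "square_integrable_on lebesgue D f"
    and v: "continuous_on (closure D) v"
  shows "set_integrable lebesgue D (\<lambda>x. f x * cnj (v x))"
proof (rule set_integrable_square_integrable_mult_continuous[OF _ _ _ _ f])
  show "emeasure lebesgue D < \<infinity>"
    using D emeasure_bounded_finite[of D] by (simp add: lipschitz_polyhedral_def)
  show "compact (closure D)" using D by (simp add: lipschitz_polyhedral_def)
  show "D \<in> sets borel" using D by (auto simp: lipschitz_polyhedral_def)
qed (use v in \<open>auto simp: closure_subset\<close>)

text \<open>The Bochner integral is additive only for integrable functions, which is where the integrability of the data
  and the finiteness of the surface measure enter.\<close>

lemma load_add:
  fixes \<Omega> :: "(real^'n::finite) set"
  assumes \<Omega>: "lipschitz_polyhedral \<Omega>" and f: "square_integrable_on lebesgue \<Omega> f"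
    and g: "square_integrable_on surface_measure (frontier \<Omega>) g"
    and v: "continuous_on (closure \<Omega>) v" and w: "continuous_on (closure \<Omega>) w"
  shows "load \<Omega> f g (\<lambda>x. v x + w x) = load \<Omega> f g v + load \<Omega> f g w"
  using volume_load_integrable[OF \<Omega> f v] volume_load_integrable[OF \<Omega> f w]
    surface_integrable[OF \<Omega> g v] surface_integrable[OF \<Omega> g w]
  by (simp add: load_def distrib_left)

lemma load_scale: "load \<Omega> f g (\<lambda>x. c * v x) = cnj c * load \<Omega> f g v"
proof -
  have "(\<lambda>x. h x * cnj (c * v x)) = (\<lambda>x. cnj c * (h x * cnj (v x)))" for h by (simp add: mult_ac)
  then show ?thesis unfolding load_def by (simp only: set_integral_mult_right distrib_left)
qed

section \<open>Linearity of the Helmholtz form\<close>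

definition volume_integrand ::
    "real \<Rightarrow> (real^'n \<Rightarrow> complex) \<Rightarrow> (real^'n \<Rightarrow> complex) \<Rightarrow> real^'n \<Rightarrow> complex" where
  "volume_integrand k v w x =
     (\<Sum>i\<in>UNIV. partial_deriv i v x * cnj (partial_deriv i w x)) - (of_real k)\<^sup>2 * (v x * cnj (w x))"

lemma partial_deriv_cong_open:
  assumes "open D" "x \<in> D" "\<And>y. y \<in> D \<Longrightarrow> v y = w y"
  shows "partial_deriv i v x = partial_deriv i w x"
proof -
  have "(v has_derivative F) (at x) \<longleftrightarrow> (w has_derivative F) (at x)" for F
    using assms has_derivative_transform_within_open[OF _ assms(1,2)] by metis
  then show ?thesis by (simp add: partial_deriv_def frechet_derivative_def)
qed

lemma sesq_cong_left:
  fixes D :: "(real^'n::finite) set"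
  assumes D: "open D" and eq: "\<And>x. x \<in> closure D \<Longrightarrow> v x = v' x"
  shows "sesq k D v w = sesq k D v' w"
proof -
  have eqD: "v x = v' x" if "x \<in> D" for x using eq that closure_subset by blast
  have eqF: "v x = v' x" if "x \<in> frontier D" for x using eq that by (simp add: frontier_def)
  have pd: "partial_deriv i v x = partial_deriv i v' x" if "x \<in> D" for i x
    using partial_deriv_cong_open[OF D that, of v v' i] eqD by blast
  have "(LINT x:D|lebesgue. (\<Sum>i\<in>UNIV. partial_deriv i v x * cnj (partial_deriv i w x))
        - (of_real k)\<^sup>2 * (v x * cnj (w x))) =
      (LINT x:D|lebesgue. (\<Sum>i\<in>UNIV. partial_deriv i v' x * cnj (partial_deriv i w x))
        - (of_real k)\<^sup>2 * (v' x * cnj (w x)))"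
    using D by (intro set_lebesgue_integral_cong) (auto simp: pd eqD)
  moreover have "(LINT x:frontier D|surface_measure. v x * cnj (w x)) =
      (LINT x:frontier D|surface_measure. v' x * cnj (w x))"
    using borel_sets_surface_measure by (intro set_lebesgue_integral_cong) (auto simp: eqF)
  ultimately show ?thesis by (simp add: sesq_def)
qed

context simplicial_mesh
begin

text \<open>A common description of the elements of the global space and of the local spaces, as seen on a subset \<open>D\<close>
  of the domain.\<close>

definition piecewise_poly :: "(real^'n) set \<Rightarrow> (real^'n \<Rightarrow> complex) \<Rightarrow> bool" where
  "piecewise_poly D v \<longleftrightarrow> continuous_on (closure D) v \<and>
     (\<forall>T\<in>\<T>. \<exists>q\<in>polys p. \<forall>x\<in>D \<inter> T. v x = q x)"

lemma piecewise_poly_fe_space: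
  assumes "v \<in> fe_space \<Omega> \<T> p" "D \<subseteq> \<Omega>"
  shows "piecewise_poly D v"
  unfolding piecewise_poly_def
proof (intro conjI ballI)
  show "continuous_on (closure D) v"
    using assms(1) closure_mono[OF assms(2)] by (auto simp: fe_space_def intro: continuous_on_subset)
  fix T assume "T \<in> \<T>"
  then obtain q where "q \<in> polys p" "\<forall>x\<in>T. v x = q x" using assms(1) by (auto simp: fe_space_def)
  then show "\<exists>q\<in>polys p. \<forall>x\<in>D \<inter> T. v x = q x" by (intro bexI[of _ q]) auto
qed

lemma piecewise_poly_local_space:
  assumes "v \<in> local_space \<Omega> \<T> p D" "D \<subseteq> \<Omega>"
  shows "piecewise_poly D v"
proof -
  obtain u where u: "u \<in> fe_space \<Omega> \<T> p" "v = restr (closure D) u"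
    using assms unfolding local_space_def by blast
  have eq: "v x = u x" if "x \<in> closure D" for x using that u(2) by (simp add: restr_def)
  have pu: "piecewise_poly D u" using piecewise_poly_fe_space[OF u(1) assms(2)] .
  have "continuous_on (closure D) v"
    using pu eq by (simp add: piecewise_poly_def cong: continuous_on_cong)
  moreover have "v x = u x" if "x \<in> D" for x using eq that closure_subset by blast
  then have "\<forall>T\<in>\<T>. \<exists>q\<in>polys p. \<forall>x\<in>D \<inter> T. v x = q x"
    using pu unfolding piecewise_poly_def by auto
  ultimately show ?thesis by (simp add: piecewise_poly_def)
qed

lemma piecewise_poly_add:
  assumes "piecewise_poly D v" "piecewise_poly D w"
  shows "piecewise_poly D (\<lambda>x. v x + w x)"
  unfolding piecewise_poly_def
proof (intro conjI ballI)
  show "continuous_on (closure D) (\<lambda>x. v x + w x)"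
    using assms by (auto simp: piecewise_poly_def intro: continuous_intros)
  fix T assume "T \<in> \<T>"
  then obtain q r where "q \<in> polys p" "\<forall>x\<in>D \<inter> T. v x = q x" "r \<in> polys p" "\<forall>x\<in>D \<inter> T. w x = r x"
    using assms unfolding piecewise_poly_def by metis
  then show "\<exists>q\<in>polys p. \<forall>x\<in>D \<inter> T. v x + w x = q x"
    by (intro bexI[of _ "\<lambda>x. q x + r x"] polys_add) auto
qed

lemma piecewise_poly_scale:
  assumes "piecewise_poly D v"
  shows "piecewise_poly D (\<lambda>x. c * v x)"
  unfolding piecewise_poly_def
proof (intro conjI ballI)
  show "continuous_on (closure D) (\<lambda>x. c * v x)"
    using assms by (auto simp: piecewise_poly_def intro: continuous_intros)
  fix T assume "T \<in> \<T>"
  then obtain q where "q \<in> polys p" "\<forall>x\<in>D \<inter> T. v x = q x"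
    using assms unfolding piecewise_poly_def by metis
  then show "\<exists>q\<in>polys p. \<forall>x\<in>D \<inter> T. c * v x = q x"
    by (intro bexI[of _ "\<lambda>x. c * q x"] polys_scale) auto
qed

text \<open>Differentiation is local, so in the interior of a simplex the partial derivatives are those of a
  polynomial and therefore bounded on bounded sets.\<close>

lemma piecewise_poly_on_interior:
  assumes D: "open D" and v: "piecewise_poly D v" and T: "T \<in> \<T>"
  obtains q where "q \<in> polys p"
    "\<And>x. x \<in> D \<inter> interior T \<Longrightarrow> v x = q x \<and> v differentiable (at x) \<and>
      (\<forall>i. partial_deriv i v x = partial_deriv i q x)"
proof -
  obtain q where q: "q \<in> polys p" "\<forall>x\<in>D \<inter> T. v x = q x"
    using v T unfolding piecewise_poly_def by blast
  have "v x = q x \<and> v differentiable (at x) \<and> (\<forall>i. partial_deriv i v x = partial_deriv i q x)"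
    if x: "x \<in> D \<inter> interior T" for x
  proof -
    have o: "open (D \<inter> interior T)" using D by auto
    have eq: "v y = q y" if "y \<in> D \<inter> interior T" for y
      using q(2) that interior_subset by blast
    obtain F where F: "(q has_derivative F) (at x)"
      using polys_has_continuous_partials[OF q(1)]
      unfolding has_continuous_partials_def differentiable_def by blast
    have "(v has_derivative F) (at x)"
      by (rule has_derivative_transform_within_open[OF F o x]) (simp add: eq)
    then show ?thesis
      using eq[OF x] partial_deriv_cong_open[OF o x eq] by (auto simp: differentiable_def)
  qed
  then show ?thesis using that q(1) by blast
qed

lemma piecewise_poly_differentiable:
  assumes D: "open D" "D \<subseteq> \<Union>\<T>" and v: "piecewise_poly D v" and x: "x \<in> D - skeleton"
  shows "v differentiable (at x)"
proof -
  have "x \<in> \<Union>\<T>" "x \<notin> skeleton" using D x by auto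
  then obtain T where T: "T \<in> \<T>" "x \<in> interior T" using interior_of_cell by blast
  show ?thesis using piecewise_poly_on_interior[OF D(1) v T(1)] x T(2) by (metis DiffD1 IntI)
qed

lemma volume_integrand_integrable:
  assumes D: "open D" "bounded D" "D \<subseteq> \<Union>\<T>" and v: "piecewise_poly D v" and w: "piecewise_poly D w"
  shows "set_integrable lebesgue D (volume_integrand k v w)"
proof -
  have cell: "set_integrable lebesgue (D \<inter> interior T) (volume_integrand k v w)" if T: "T \<in> \<T>" for T
  proof -
    obtain q where q: "q \<in> polys p" "\<And>x. x \<in> D \<inter> interior T \<Longrightarrow> v x = q x \<and> v differentiable (at x) \<and>
        (\<forall>i. partial_deriv i v x = partial_deriv i q x)"
      using piecewise_poly_on_interior[OF D(1) v T] by blast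
    obtain r where r: "r \<in> polys p" "\<And>x. x \<in> D \<inter> interior T \<Longrightarrow> w x = r x \<and> w differentiable (at x) \<and>
        (\<forall>i. partial_deriv i w x = partial_deriv i r x)"
      using piecewise_poly_on_interior[OF D(1) w T] by blast
    have "continuous_on UNIV (partial_deriv i q)" "continuous_on UNIV (partial_deriv i r)" for i
      using polys_has_continuous_partials q(1) r(1) by (auto simp: has_continuous_partials_def)
    then have "continuous_on UNIV (volume_integrand k q r)"
      unfolding volume_integrand_def
      using polys_continuous_on[OF q(1), of UNIV] polys_continuous_on[OF r(1), of UNIV]
      by (intro continuous_intros) auto
    then have "continuous_on (closure D) (volume_integrand k q r)"
      by (rule continuous_on_subset) simp
    moreover have "compact (closure D)" using D by simp
    ultimately have "integrable lborel (\<lambda>x. indicator (closure D) x *\<^sub>R volume_integrand k q r x)"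
      by (intro borel_integrable_compact)
    then have "set_integrable lebesgue (closure D) (volume_integrand k q r)"
      unfolding set_integrable_def by (subst integrable_completion) auto
    then have "set_integrable lebesgue (D \<inter> interior T) (volume_integrand k q r)"
    proof (rule set_integrable_subset)
      show "D \<inter> interior T \<in> sets lebesgue" using D(1) by (intro sets_completionI_sets) auto
      show "D \<inter> interior T \<subseteq> closure D" using closure_subset by blast
    qed
    moreover have "volume_integrand k q r x = volume_integrand k v w x" if "x \<in> D \<inter> interior T" for x
      using q(2)[OF that] r(2)[OF that] by (simp add: volume_integrand_def)
    ultimately show ?thesis using set_integrable_cong[OF refl refl] by blast
  qed
  have "set_integrable lebesgue (\<Union>T\<in>\<T>. D \<inter> interior T) (volume_integrand k v w)"
    using finite_mesh cell D(1) by (intro set_integrable_UN) auto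
  then show ?thesis
  proof (rule absolutely_integrable_spike_set)
    have "D - (\<Union>T\<in>\<T>. D \<inter> interior T) \<subseteq> skeleton"
    proof
      fix x assume x: "x \<in> D - (\<Union>T\<in>\<T>. D \<inter> interior T)"
      show "x \<in> skeleton"
      proof (rule ccontr)
        assume "x \<notin> skeleton"
        moreover have "x \<in> \<Union>\<T>" using x D(3) by (auto simp: subset_iff)
        ultimately obtain T where "T \<in> \<T>" "x \<in> interior T" using interior_of_cell by metis
        then show False using x by blast
      qed
    qed
    then show "negligible {x \<in> D - (\<Union>T\<in>\<T>. D \<inter> interior T). volume_integrand k v w x \<noteq> 0}"
      by (intro negligible_subset[OF negligible_skeleton]) blast
    have "{x \<in> (\<Union>T\<in>\<T>. D \<inter> interior T) - D. volume_integrand k v w x \<noteq> 0} = {}" by blast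
    then show "negligible {x \<in> (\<Union>T\<in>\<T>. D \<inter> interior T) - D. volume_integrand k v w x \<noteq> 0}"
      by (simp only: negligible_empty)
  qed
qed

text \<open>Identities for the integrand need only be checked off the skeleton, where derivatives exist.\<close>

lemma volume_integral_cong:
  fixes F G :: "real^'n \<Rightarrow> complex"
  assumes "set_integrable lebesgue D F" "set_integrable lebesgue D G"
    and "\<And>x. x \<in> D - skeleton \<Longrightarrow> F x = G x"
  shows "(LINT x:D|lebesgue. F x) = (LINT x:D|lebesgue. G x)"
  using assms integral_spike[OF negligible_skeleton, of D G F]
  by (simp add: set_lebesgue_integral_eq_integral)

lemma sesq_volume:
  "sesq k D v w = (LINT x:D|lebesgue. volume_integrand k v w x)
     - \<i> * of_real k * (LINT x:frontier D|surface_measure. v x * cnj (w x))"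
  by (simp add: sesq_def volume_integrand_def)

lemma sesq_add_left:
  assumes D: "lipschitz_polyhedral D" "D \<subseteq> \<Union>\<T>"
    and v: "piecewise_poly D v" and v': "piecewise_poly D v'" and w: "piecewise_poly D w"
  shows "sesq k D (\<lambda>x. v x + v' x) w = sesq k D v w + sesq k D v' w"
proof -
  have oD: "open D" "bounded D" using D by (auto simp: lipschitz_polyhedral_def)
  note int = volume_integrand_integrable[OF oD D(2)]
  have "(LINT x:D|lebesgue. volume_integrand k (\<lambda>x. v x + v' x) w x) =
      (LINT x:D|lebesgue. volume_integrand k v w x + volume_integrand k v' w x)"
  proof (rule volume_integral_cong)
    fix x assume x: "x \<in> D - skeleton"
    show "volume_integrand k (\<lambda>x. v x + v' x) w x = volume_integrand k v w x + volume_integrand k v' w x"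
      using piecewise_poly_differentiable[OF oD(1) D(2) _ x] v v'
      by (simp add: volume_integrand_def partial_deriv_add algebra_simps sum.distrib)
  qed (auto intro!: int piecewise_poly_add v v' w set_integral_add)
  also have "\<dots> = (LINT x:D|lebesgue. volume_integrand k v w x) + (LINT x:D|lebesgue. volume_integrand k v' w x)"
    by (intro set_integral_add int v v' w)
  finally have vol: "(LINT x:D|lebesgue. volume_integrand k (\<lambda>x. v x + v' x) w x) = \<dots>" .
  have "set_integrable surface_measure (frontier D) (\<lambda>x. v x * cnj (w x))"
    "set_integrable surface_measure (frontier D) (\<lambda>x. v' x * cnj (w x))"
    using surface_integrable_continuous[OF D(1)] v v' w by (auto simp: piecewise_poly_def)
  then show ?thesis unfolding sesq_volume vol by (simp add: algebra_simps)
qed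

lemma sesq_add_right:
  assumes D: "lipschitz_polyhedral D" "D \<subseteq> \<Union>\<T>"
    and v: "piecewise_poly D v" and w: "piecewise_poly D w" and w': "piecewise_poly D w'"
  shows "sesq k D v (\<lambda>x. w x + w' x) = sesq k D v w + sesq k D v w'"
proof -
  have oD: "open D" "bounded D" using D by (auto simp: lipschitz_polyhedral_def)
  note int = volume_integrand_integrable[OF oD D(2)]
  have "(LINT x:D|lebesgue. volume_integrand k v (\<lambda>x. w x + w' x) x) =
      (LINT x:D|lebesgue. volume_integrand k v w x + volume_integrand k v w' x)"
  proof (rule volume_integral_cong)
    fix x assume x: "x \<in> D - skeleton"
    show "volume_integrand k v (\<lambda>x. w x + w' x) x = volume_integrand k v w x + volume_integrand k v w' x"
      using piecewise_poly_differentiable[OF oD(1) D(2) _ x] w w'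
      by (simp add: volume_integrand_def partial_deriv_add algebra_simps sum.distrib)
  qed (auto intro!: int piecewise_poly_add v w w' set_integral_add)
  also have "\<dots> = (LINT x:D|lebesgue. volume_integrand k v w x) + (LINT x:D|lebesgue. volume_integrand k v w' x)"
    by (intro set_integral_add int v w w')
  finally have vol: "(LINT x:D|lebesgue. volume_integrand k v (\<lambda>x. w x + w' x) x) = \<dots>" .
  have "set_integrable surface_measure (frontier D) (\<lambda>x. v x * cnj (w x))"
    "set_integrable surface_measure (frontier D) (\<lambda>x. v x * cnj (w' x))"
    using surface_integrable_continuous[OF D(1)] v w w' by (auto simp: piecewise_poly_def)
  then show ?thesis unfolding sesq_volume vol by (simp add: algebra_simps)
qed

lemma sesq_scale_right:
  assumes D: "lipschitz_polyhedral D" "D \<subseteq> \<Union>\<T>"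
    and v: "piecewise_poly D v" and w: "piecewise_poly D w"
  shows "sesq k D v (\<lambda>x. c * w x) = cnj c * sesq k D v w"
proof -
  have oD: "open D" "bounded D" using D by (auto simp: lipschitz_polyhedral_def)
  note int = volume_integrand_integrable[OF oD D(2)]
  have "(LINT x:D|lebesgue. volume_integrand k v (\<lambda>x. c * w x) x) =
      (LINT x:D|lebesgue. cnj c * volume_integrand k v w x)"
  proof (rule volume_integral_cong)
    fix x assume x: "x \<in> D - skeleton"
    show "volume_integrand k v (\<lambda>x. c * w x) x = cnj c * volume_integrand k v w x"
      using piecewise_poly_differentiable[OF oD(1) D(2) _ x] w
      by (simp add: volume_integrand_def partial_deriv_scale algebra_simps sum_distrib_left)
  qed (auto intro!: int piecewise_poly_scale v w)
  moreover have "(\<lambda>x. v x * cnj (c * w x)) = (\<lambda>x. cnj c * (v x * cnj (w x)))" by (simp add: mult_ac)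
  ultimately show ?thesis
    unfolding sesq_volume by (simp only: set_integral_mult_right) (simp add: algebra_simps)
qed

section \<open>One step of the two iterations\<close>

text \<open>The residual functional has to be antilinear on the local space, as this is what puts it into the range of the local
  operator.\<close>

lemma antidual_restriction_residual:
  assumes \<Omega>: "lipschitz_polyhedral \<Omega>" "closure \<Omega> = \<Union>\<T>"
    and f: "square_integrable_on lebesgue \<Omega> f" and g: "square_integrable_on surface_measure (frontier \<Omega>) g"
    and u: "u \<in> fe_space \<Omega> \<T> p"
  shows "restriction_op \<Omega> \<T> p D (\<lambda>v. load_op \<Omega> \<T> p f g v - global_op \<Omega> \<T> p k u v) \<in>
    antidual (local_space \<Omega> \<T> p D)"
proof -
  let ?V = "fe_space \<Omega> \<T> p" and ?Vj = "local_space \<Omega> \<T> p D" and ?E = "zero_ext \<Omega> \<T> p D"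
  have sub: "\<Omega> \<subseteq> \<Union>\<T>" using \<Omega>(2) closure_subset by blast
  have E: "?E v \<in> ?V" for v by (rule zero_ext_in[OF \<Omega>(2)])
  have pw: "piecewise_poly \<Omega> v" if "v \<in> ?V" for v using piecewise_poly_fe_space[OF that] by simp
  have cont: "continuous_on (closure \<Omega>) v" if "v \<in> ?V" for v using that by (simp add: fe_space_def)
  have scale: "(\<lambda>x. c * v x) \<in> ?Vj" if v: "v \<in> ?Vj" for c v
  proof -
    obtain u where "u \<in> ?V" "v = restr (closure D) u" using v unfolding local_space_def by blast
    then have "(\<lambda>x. c * v x) = restr (closure D) (\<lambda>x. c * u x)" "(\<lambda>x. c * u x) \<in> ?V"
      by (auto simp: restr_def fe_space_scale)
    then show ?thesis unfolding local_space_def by blast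
  qed
  have eq: "restriction_op \<Omega> \<T> p D (\<lambda>v. load_op \<Omega> \<T> p f g v - global_op \<Omega> \<T> p k u v) =
      functional_on ?Vj (\<lambda>v. load \<Omega> f g (?E v) - sesq k \<Omega> u (?E v))"
    by (simp add: restriction_op_def functional_on_def load_op_def global_op_def E fun_eq_iff)
  show ?thesis
    unfolding eq antidual_def
  proof (intro CollectI conjI ballI allI impI)
    fix v w assume v: "v \<in> ?Vj" and w: "w \<in> ?Vj"
    show "functional_on ?Vj (\<lambda>v. load \<Omega> f g (?E v) - sesq k \<Omega> u (?E v)) (\<lambda>x. v x + w x) =
        functional_on ?Vj (\<lambda>v. load \<Omega> f g (?E v) - sesq k \<Omega> u (?E v)) v +
        functional_on ?Vj (\<lambda>v. load \<Omega> f g (?E v) - sesq k \<Omega> u (?E v)) w"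
      using local_space_add[OF v w] v w load_add[OF \<Omega>(1) f g cont[OF E] cont[OF E], of v w]
        sesq_add_right[OF \<Omega>(1) sub pw[OF u] pw[OF E] pw[OF E], of k v w]
      by (simp add: functional_on_def zero_ext_add[OF \<Omega>(2)])
  next
    fix c v assume v: "v \<in> ?Vj"
    show "functional_on ?Vj (\<lambda>v. load \<Omega> f g (?E v) - sesq k \<Omega> u (?E v)) (\<lambda>x. c * v x) =
        cnj c * functional_on ?Vj (\<lambda>v. load \<Omega> f g (?E v) - sesq k \<Omega> u (?E v)) v"
      using scale[OF v] v sesq_scale_right[OF \<Omega>(1) sub pw[OF u] pw[OF E], of k c v]
      by (simp add: functional_on_def zero_ext_scale[OF \<Omega>(2)] load_scale algebra_simps)
  qed (simp add: functional_on_def)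
qed

text \<open>The transfer form contains the term \<open>a\<^sub>D(u, v)\<close>, which depends only on the restriction of \<open>u\<close>. Moving it to the
  left-hand side of the local problem leaves exactly the equation that defines the ORAS correction \<open>c\<close>.\<close>

lemma local_solution_correction:
  assumes \<Omega>: "lipschitz_polyhedral \<Omega>" "closure \<Omega> = \<Union>\<T>"
    and f: "square_integrable_on lebesgue \<Omega> f" and g: "square_integrable_on surface_measure (frontier \<Omega>) g"
    and D: "lipschitz_polyhedral D" "D \<subseteq> \<Omega>"
    and bij: "bij_betw (local_op \<Omega> \<T> p k D) (local_space \<Omega> \<T> p D) (antidual (local_space \<Omega> \<T> p D))"
    and u: "u \<in> fe_space \<Omega> \<T> p"
    and c_def: "c = inv_into (local_space \<Omega> \<T> p D) (local_op \<Omega> \<T> p k D)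
      (restriction_op \<Omega> \<T> p D (\<lambda>v. load_op \<Omega> \<T> p f g v - global_op \<Omega> \<T> p k u v))"
  shows "local_solution \<Omega> \<T> p k f g D u s \<longleftrightarrow> s = (\<lambda>x. restr (closure D) u x + c x)"
proof -
  let ?Vj = "local_space \<Omega> \<T> p D" and ?E = "zero_ext \<Omega> \<T> p D"
  let ?r = "restriction_op \<Omega> \<T> p D (\<lambda>v. load_op \<Omega> \<T> p f g v - global_op \<Omega> \<T> p k u v)"
  let ?s = "\<lambda>x. restr (closure D) u x + c x"
  have "?r \<in> local_op \<Omega> \<T> p k D ` ?Vj"
    using antidual_restriction_residual[OF \<Omega> f g u] bij_betw_imp_surj_on[OF bij] by simp
  then have cV: "c \<in> ?Vj" and c: "local_op \<Omega> \<T> p k D c = ?r"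
    unfolding c_def by (rule inv_into_into, rule f_inv_into_f)
  have ruV: "restr (closure D) u \<in> ?Vj" using u by (simp add: local_space_def)
  have sV: "?s \<in> ?Vj" by (rule local_space_add[OF ruV cV])
  have sub: "D \<subseteq> \<Union>\<T>" using \<Omega>(2) D(2) closure_subset by blast
  have pw: "piecewise_poly D v" if "v \<in> ?Vj" for v using piecewise_poly_local_space[OF that D(2)] .
  have s: "sesq k D ?s v = load \<Omega> f g (?E v) + transfer_form \<Omega> \<T> p k D u v" if v: "v \<in> ?Vj" for v
  proof -
    have "sesq k D c v = load \<Omega> f g (?E v) - sesq k \<Omega> u (?E v)"
      using fun_cong[OF c, of v] v zero_ext_in[OF \<Omega>(2)]
      by (simp add: local_op_def restriction_op_def functional_on_def load_op_def global_op_def)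
    moreover have "sesq k D (restr (closure D) u) v = sesq k D u v"
      using D(1) by (intro sesq_cong_left) (auto simp: lipschitz_polyhedral_def restr_def)
    ultimately show ?thesis
      using sesq_add_left[OF D(1) sub pw[OF ruV] pw[OF cV] pw[OF v]]
      by (simp add: transfer_form_def)
  qed
  show ?thesis
  proof
    assume "s = ?s"
    then show "local_solution \<Omega> \<T> p k f g D u s" using sV s by (simp add: local_solution_def)
  next
    assume *: "local_solution \<Omega> \<T> p k f g D u s"
    then have "local_op \<Omega> \<T> p k D s = local_op \<Omega> \<T> p k D ?s"
      using s by (auto simp: local_solution_def local_op_def functional_on_def)
    then show "s = ?s"
      using * sV inj_onD[OF bij_betw_imp_inj_on[OF bij]] by (simp add: local_solution_def)
  qed
qed

end

theorem theorem2p5: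
  fixes \<Omega> :: "(real^'n) set" and \<T> :: "(real^'n) set set" and \<Omega>s :: "nat \<Rightarrow> (real^'n) set"
    and \<eta> :: "nat \<Rightarrow> real^'n \<Rightarrow> real" and f g u0 :: "real^'n \<Rightarrow> complex"
    and k :: real and p N :: nat
  assumes dim: "CARD('n) = 2 \<or> CARD('n) = 3"
    and domain: "lipschitz_polyhedral \<Omega>" "connected \<Omega>"
    and wavenumber: "k > 0"
    and data: "square_integrable_on lebesgue \<Omega> f"
      "square_integrable_on surface_measure (frontier \<Omega>) g"
    and degree: "p \<ge> 1"
    and mesh: "conforming_simplicial_mesh \<T> \<Omega>"
    and cover: "overlapping_cover \<T> \<Omega> N \<Omega>s"
    and unity: "partition_of_unity \<Omega> N \<Omega>s \<eta>"
    and wellposed: "\<exists>!u. u \<in> fe_space \<Omega> \<T> p \<and> (\<forall>v\<in>fe_space \<Omega> \<T> p. sesq k \<Omega> u v = load \<Omega> f g v)"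
    and invertible: "\<And>j. j \<in> {1..N} \<Longrightarrow>
      bij_betw (local_op \<Omega> \<T> p k (\<Omega>s j)) (local_space \<Omega> \<T> p (\<Omega>s j))
        (antidual (local_space \<Omega> \<T> p (\<Omega>s j)))"
    and start: "u0 \<in> fe_space \<Omega> \<T> p"
  shows "\<forall>n. schwarz_iter \<Omega> \<T> p k f g N \<Omega>s \<eta> u0 n \<in> fe_space \<Omega> \<T> p \<and>
    (\<forall>j\<in>{1..N}. \<exists>!s. local_solution \<Omega> \<T> p k f g (\<Omega>s j) (schwarz_iter \<Omega> \<T> p k f g N \<Omega>s \<eta> u0 n) s) \<and>
    schwarz_iter \<Omega> \<T> p k f g N \<Omega>s \<eta> u0 n = richardson_iter \<Omega> \<T> p k f g N \<Omega>s \<eta> u0 n"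
proof -
  interpret simplicial_mesh \<T> p
    using mesh degree by unfold_locales (auto simp: conforming_simplicial_mesh_def)
  have closure: "closure \<Omega> = \<Union>\<T>" using mesh by (simp add: conforming_simplicial_mesh_def)
  let ?V = "fe_space \<Omega> \<T> p"
  let ?S = "schwarz_iter \<Omega> \<T> p k f g N \<Omega>s \<eta> u0" and ?R = "richardson_iter \<Omega> \<T> p k f g N \<Omega>s \<eta> u0"
  define c where "c u j = inv_into (local_space \<Omega> \<T> p (\<Omega>s j)) (local_op \<Omega> \<T> p k (\<Omega>s j))
      (restriction_op \<Omega> \<T> p (\<Omega>s j) (\<lambda>v. load_op \<Omega> \<T> p f g v - global_op \<Omega> \<T> p k u v))" for u j
  have D: "lipschitz_polyhedral (\<Omega>s j)" "\<Omega>s j \<subseteq> \<Omega>" if "j \<in> {1..N}" for j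
    using cover that unfolding overlapping_cover_def by auto
  have cells: "closure (\<Omega>s j) \<subseteq> \<Union>{T\<in>\<T>. T \<subseteq> closure (\<Omega>s j)}" if j: "j \<in> {1..N}" for j
  proof (rule resolved_closure_is_union_of_cells)
    show "open (\<Omega>s j)" using D(1)[OF j] by (simp add: lipschitz_polyhedral_def)
    show "\<Omega>s j \<subseteq> \<Union>\<T>" using D(2)[OF j] closure closure_subset[of \<Omega>] by (simp add: subset_trans)
    show "resolves_boundary \<T> (\<Omega>s j)" using cover j by (simp add: overlapping_cover_def)
  qed
  have solution: "local_solution \<Omega> \<T> p k f g (\<Omega>s j) u s \<longleftrightarrow>
      s = (\<lambda>x. restr (closure (\<Omega>s j)) u x + c u j x)" if "j \<in> {1..N}" "u \<in> ?V" for j u s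
    using local_solution_correction[OF domain(1) closure data D[OF that(1)] invertible[OF that(1)] that(2) c_def] .
  have unique: "\<exists>!s. local_solution \<Omega> \<T> p k f g (\<Omega>s j) u s" if "j \<in> {1..N}" "u \<in> ?V" for j u
    using solution[OF that] by simp
  have step: "(\<lambda>x. \<Sum>l\<in>{1..N}. weighted_ext \<Omega> \<T> p (\<Omega>s l) (\<eta> l)
        (THE s. local_solution \<Omega> \<T> p k f g (\<Omega>s l) u s) x) =
      (\<lambda>x. u x + oras_prec \<Omega> \<T> p k N \<Omega>s \<eta>
        (\<lambda>v. load_op \<Omega> \<T> p f g v - global_op \<Omega> \<T> p k u v) x)" if u: "u \<in> ?V" for u
  proof
    fix x
    have "(\<Sum>l\<in>{1..N}. weighted_ext \<Omega> \<T> p (\<Omega>s l) (\<eta> l)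
          (THE s. local_solution \<Omega> \<T> p k f g (\<Omega>s l) u s) x) =
        (\<Sum>l\<in>{1..N}. weighted_ext \<Omega> \<T> p (\<Omega>s l) (\<eta> l) (restr (closure (\<Omega>s l)) u) x +
          weighted_ext \<Omega> \<T> p (\<Omega>s l) (\<eta> l) (c u l) x)"
      using solution[OF _ u] weighted_ext_add[OF closure cells] by (intro sum.cong) simp_all
    also have "\<dots> = u x + (\<Sum>l\<in>{1..N}. weighted_ext \<Omega> \<T> p (\<Omega>s l) (\<eta> l) (c u l) x)"
      using fun_cong[OF sum_weighted_ext[OF closure cells unity u], of x] by (simp add: sum.distrib)
    finally show "(\<Sum>l\<in>{1..N}. weighted_ext \<Omega> \<T> p (\<Omega>s l) (\<eta> l)
          (THE s. local_solution \<Omega> \<T> p k f g (\<Omega>s l) u s) x) =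
        u x + oras_prec \<Omega> \<T> p k N \<Omega>s \<eta> (\<lambda>v. load_op \<Omega> \<T> p f g v - global_op \<Omega> \<T> p k u v) x"
      by (simp add: oras_prec_def c_def)
  qed
  have "?S n \<in> ?V \<and> ?S n = ?R n" for n
  proof (induction n)
    case 0
    then show ?case using start by simp
  next
    case (Suc n)
    have "?S (Suc n) \<in> ?V" by (simp add: fe_space_sum weighted_ext_in closure)
    moreover have "?S (Suc n) = ?R (Suc n)" using Suc step[OF conjunct1[OF Suc.IH]] by (simp add: Let_def)
    ultimately show ?case by blast
  qed
  then show ?thesis using unique by blast
qed

end
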